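(* Let $T\in\mathcal B(\mathcal H)$ be a quasi-Brownian isometry. Then the Cauchy dual $T'$ is a subnormal contraction and $$T'^{*n}T'^n=(I+T^*T)^{-1}\big(I+(T^*T)^{1-2n}\big),\qquad n=0,1,2,\ldots.$$
   Context: A $2$-isometry is $T$ with $I-2T^*T+T^{*2}T^2=0$; then $\Delta_T:=T^*T-I\ge0$ and $T$ is left-invertible. The Cauchy dual is $T'=T(T^*T)^{-1}$. $T$ is a quasi-Brownian isometry if it is a $2$-isometry with $\Delta_T T=\Delta_T^{1/2}T\Delta_T^{1/2}$. *)

theory Defs
  imports "HOL-Analysis.Analysis"
begin

class complex_inner = real_normed_vector +
  fixes scaleC :: "complex \<Rightarrow> 'a \<Rightarrow> 'a" (infixr \<open>*\<^sub>C\<close> 75)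
    and cinner :: "'a \<Rightarrow> 'a \<Rightarrow> complex"
  assumes scaleC_add_right: "scaleC a (x + y) = scaleC a x + scaleC a y"
    and scaleC_add_left: "scaleC (a + b) x = scaleC a x + scaleC b x"
    and scaleC_scaleC: "scaleC a (scaleC b x) = scaleC (a * b) x"
    and scaleC_one: "scaleC 1 x = x"
    and scaleR_scaleC: "scaleR r x = scaleC (complex_of_real r) x"
    and cinner_add_left: "cinner (x + y) z = cinner x z + cinner y z"
    and cinner_scaleC_left: "cinner (scaleC a x) y = a * cinner x y"
    and cinner_commute: "cinner x y = cnj (cinner y x)"
    and cinner_self_nonneg: "Im (cinner x x) = 0 \<and> 0 \<le> Re (cinner x x)"
    and cinner_self_eq_0: "cinner x x = 0 \<longleftrightarrow> x = 0"
    and norm_eq_sqrt_cinner: "norm x = sqrt (Re (cinner x x))"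

class chilbert = complex_inner + complete_space

definition clinear_op :: "('a::complex_inner \<Rightarrow> 'a) \<Rightarrow> bool" where
  "clinear_op T \<longleftrightarrow> (\<forall>x y. T (x + y) = T x + T y) \<and> (\<forall>a x. T (a *\<^sub>C x) = a *\<^sub>C T x)"

definition bounded_op :: "('a::complex_inner \<Rightarrow> 'a) \<Rightarrow> bool" where
  "bounded_op T \<longleftrightarrow> clinear_op T \<and> (\<exists>C. \<forall>x. norm (T x) \<le> C * norm x)"

text \<open>Hilbert space adjoint (exists and is unique for bounded operators on a Hilbert space).\<close>
definition cadj :: "('a::complex_inner \<Rightarrow> 'a) \<Rightarrow> 'a \<Rightarrow> 'a" where
  "cadj T = (SOME S. \<forall>x y. cinner (T x) y = cinner x (S y))"

definition positive_op :: "('a::complex_inner \<Rightarrow> 'a) \<Rightarrow> bool" where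
  "positive_op A \<longleftrightarrow> bounded_op A \<and> (\<forall>x. Im (cinner (A x) x) = 0 \<and> 0 \<le> Re (cinner (A x) x))"

definition op_sqrt :: "('a::complex_inner \<Rightarrow> 'a) \<Rightarrow> 'a \<Rightarrow> 'a" where
  "op_sqrt A = (THE B. positive_op B \<and> B \<circ> B = A)"

definition op_ipow :: "('a \<Rightarrow> 'a) \<Rightarrow> int \<Rightarrow> 'a \<Rightarrow> 'a" where
  "op_ipow A k = (if 0 \<le> k then A ^^ nat k else (inv A) ^^ nat (- k))"

definition two_isometry :: "('a::complex_inner \<Rightarrow> 'a) \<Rightarrow> bool" where
  "two_isometry T \<longleftrightarrow> bounded_op T \<and>
     (\<forall>x. x - 2 *\<^sub>C cadj T (T x) + cadj T (cadj T (T (T x))) = 0)"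

definition Delta :: "('a::complex_inner \<Rightarrow> 'a) \<Rightarrow> 'a \<Rightarrow> 'a" where
  "Delta T = (\<lambda>x. cadj T (T x) - x)"

definition cauchy_dual :: "('a::complex_inner \<Rightarrow> 'a) \<Rightarrow> 'a \<Rightarrow> 'a" where
  "cauchy_dual T = T \<circ> inv (cadj T \<circ> T)"

definition quasi_brownian :: "('a::complex_inner \<Rightarrow> 'a) \<Rightarrow> bool" where
  "quasi_brownian T \<longleftrightarrow> two_isometry T \<and>
     Delta T \<circ> T = op_sqrt (Delta T) \<circ> T \<circ> op_sqrt (Delta T)"

definition contraction :: "('a::complex_inner \<Rightarrow> 'a) \<Rightarrow> bool" where
  "contraction T \<longleftrightarrow> bounded_op T \<and> (\<forall>x. norm (T x) \<le> norm x)"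

record 'u hspace =
  hcarrier :: "'u set"
  hadd :: "'u \<Rightarrow> 'u \<Rightarrow> 'u"
  hzero :: 'u
  hscale :: "complex \<Rightarrow> 'u \<Rightarrow> 'u"
  hinner :: "'u \<Rightarrow> 'u \<Rightarrow> complex"

definition hnorm :: "'u hspace \<Rightarrow> 'u \<Rightarrow> real" where
  "hnorm K x = sqrt (Re (hinner K x x))"

definition hdist :: "'u hspace \<Rightarrow> 'u \<Rightarrow> 'u \<Rightarrow> real" where
  "hdist K x y = hnorm K (hadd K x (hscale K (-1) y))"

definition is_hilbert_space :: "'u hspace \<Rightarrow> bool" where
  "is_hilbert_space K \<longleftrightarrow>
     (let V = hcarrier K; add = hadd K; z = hzero K; sc = hscale K; ip = hinner K in
       (z :: 'u) \<in> V \<and> (\<forall>x\<in>V. \<forall>y\<in>V. add x y \<in> V) \<and> (\<forall>a. \<forall>x\<in>V. sc a x \<in> V)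
     \<and> (\<forall>x\<in>V. \<forall>y\<in>V. \<forall>w\<in>V. add (add x y) w = add x (add y w))
     \<and> (\<forall>x\<in>V. \<forall>y\<in>V. add x y = add y x)
     \<and> (\<forall>x\<in>V. add z x = x)
     \<and> (\<forall>x\<in>V. \<exists>y\<in>V. add x y = z)
     \<and> (\<forall>a. \<forall>x\<in>V. \<forall>y\<in>V. sc a (add x y) = add (sc a x) (sc a y))
     \<and> (\<forall>a b. \<forall>x\<in>V. sc (a + b) x = add (sc a x) (sc b x))
     \<and> (\<forall>a b. \<forall>x\<in>V. sc a (sc b x) = sc (a * b) x)
     \<and> (\<forall>x\<in>V. sc 1 x = x)
     \<and> (\<forall>x\<in>V. \<forall>y\<in>V. \<forall>w\<in>V. ip (add x y) w = ip x w + ip y w)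
     \<and> (\<forall>a. \<forall>x\<in>V. \<forall>y\<in>V. ip (sc a x) y = a * ip x y)
     \<and> (\<forall>x\<in>V. \<forall>y\<in>V. ip x y = cnj (ip y x))
     \<and> (\<forall>x\<in>V. Im (ip x x) = 0 \<and> 0 \<le> Re (ip x x))
     \<and> (\<forall>x\<in>V. ip x x = 0 \<longrightarrow> x = z)
     \<and> (\<forall>f::nat\<Rightarrow>'u. (\<forall>n. f n \<in> V) \<longrightarrow>
            (\<forall>e>(0::real). \<exists>N::nat. \<forall>m\<ge>N. \<forall>n\<ge>N. hdist K (f m) (f n) < e) \<longrightarrow>
            (\<exists>l\<in>V. \<forall>e>(0::real). \<exists>N::nat. \<forall>n\<ge>N. hdist K (f n) l < e)))"

definition hbounded_op :: "'u hspace \<Rightarrow> ('u \<Rightarrow> 'u) \<Rightarrow> bool" where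
  "hbounded_op K N \<longleftrightarrow>
     (\<forall>x\<in>hcarrier K. N x \<in> hcarrier K)
   \<and> (\<forall>x\<in>hcarrier K. \<forall>y\<in>hcarrier K. N (hadd K x y) = hadd K (N x) (N y))
   \<and> (\<forall>a. \<forall>x\<in>hcarrier K. N (hscale K a x) = hscale K a (N x))
   \<and> (\<exists>C. \<forall>x\<in>hcarrier K. hnorm K (N x) \<le> C * hnorm K x)"

definition hnormal_op :: "'u hspace \<Rightarrow> ('u \<Rightarrow> 'u) \<Rightarrow> bool" where
  "hnormal_op K N \<longleftrightarrow> hbounded_op K N \<and>
     (\<exists>M. (\<forall>y\<in>hcarrier K. M y \<in> hcarrier K)
        \<and> (\<forall>x\<in>hcarrier K. \<forall>y\<in>hcarrier K. hinner K (N x) y = hinner K x (M y))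
        \<and> (\<forall>x\<in>hcarrier K. N (M x) = M (N x)))"

text \<open>Subnormal: T has a normal extension, i.e. there is a Hilbert space K containing H
(via a linear isometric embedding J) and a normal operator N on K with \<open>N J = J T\<close>.
The ambient type of K is \<open>nat \<Rightarrow> 'a\<close>, which has enough elements to carry
(an isomorphic copy of) any normal extension, in particular the minimal one.\<close>
definition subnormal :: "('a::complex_inner \<Rightarrow> 'a) \<Rightarrow> bool" where
  "subnormal T \<longleftrightarrow> bounded_op T \<and>
     (\<exists>K J N.
        is_hilbert_space (K :: (nat \<Rightarrow> 'a) hspace) \<and> hnormal_op K N
      \<and> (\<forall>x. J x \<in> hcarrier K)
      \<and> (\<forall>x y. J (x + y) = hadd K (J x) (J y))
      \<and> (\<forall>a x. J (a *\<^sub>C x) = hscale K a (J x))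
      \<and> (\<forall>x y. hinner K (J x) (J y) = cinner x y)
      \<and> (\<forall>x. N (J x) = J (T x)))"

end

theory Submission
  imports Defs
begin

text \<open>With \<open>A = T\<^sup>*T\<close> and \<open>\<Delta> = A - I\<close>, the kernel of \<open>\<Delta>\<close> is invariant under \<open>T\<close>, and the compression
  \<open>X\<close> of \<open>T\<close> to its orthogonal complement is an isometry there that commutes with \<open>\<Delta>\<close>. Hence
  \<open>T\<^sup>* f(A) T = A + f(A) - I\<close> whenever \<open>f(1) = 1\<close>, and the moment formula for \<open>T' = T A\<^sup>-\<^sup>1\<close>
  follows by induction. As a function of \<open>n\<close> it is an operator measure with two atoms, \<open>1\<close> and \<open>A\<^sup>-\<^sup>2\<close>;
  the square roots of their weights embed the space in a sum of two copies of itself, where \<open>T'\<close> becomes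
  the restriction of an isometry plus an isometry times the commuting positive operator \<open>A\<^sup>-\<^sup>1\<close>. Such
  quasinormal operators have explicit normal extensions.\<close>

subsection \<open>Complex inner products\<close>

text \<open>Let \<open>D\<close> be the square root of \<Delta>. The quasi-Brownian condition
  \<open>D D T = D T D\<close> says that \<open>D T - T D\<close> takes values in
  \<open>ker D\<close>; projecting that kernel away restores commutation, although \<open>T\<close>
  itself need not commute with \<Delta>. The 2-isometry condition says that compressing \<Delta> by
  \<open>T\<close> returns \<Delta>, which makes \<open>X\<close> isometric where \<Delta> is
  injective. The atoms are read off from (I + A)^-1 (I + A^(1-2n)) = (I + A)^-1 1^n + A (I + A)^-1
  (A^-2)^n. The obstacle is the part of \<open>T\<close> that maps the complement into
  \<open>ker D\<close>: it keeps the Cauchy dual from commuting with the weights. Once all mass over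
  \<open>ker D\<close> sits at the atom 1, the second component does not see this part, and in the
  first one, conjugation by the invertible root of the weight absorbs it into an isometry.\<close>

lemma cinner_self: "cinner x x = complex_of_real ((norm x)\<^sup>2)"
  for x :: "'a::complex_inner"
  using cinner_self_nonneg[of x] by (simp add: norm_eq_sqrt_cinner complex_eq_iff)

lemma cinner_scaleC_right: "cinner x (a *\<^sub>C y) = cnj a * cinner x y"
  for x y :: "'a::complex_inner"
  by (metis cinner_commute cinner_scaleC_left complex_cnj_mult)

lemma cinner_add_right: "cinner x (y + z) = cinner x y + cinner x z"
  for x y z :: "'a::complex_inner"
  by (metis cinner_commute cinner_add_left complex_cnj_add)

lemma norm_scaleC: "norm (a *\<^sub>C x) = cmod a * norm x"
  for x :: "'a::complex_inner"
proof -
  have "cinner (a *\<^sub>C x) (a *\<^sub>C x) = (a * cnj a) * cinner x x"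
    by (simp add: cinner_scaleC_left cinner_scaleC_right mult.assoc)
  also have "\<dots> = complex_of_real ((cmod a * norm x)\<^sup>2)"
    by (simp add: cinner_self complex_norm_square[symmetric] power_mult_distrib)
  finally have "(norm (a *\<^sub>C x))\<^sup>2 = (cmod a * norm x)\<^sup>2"
    by (simp only: cinner_self of_real_eq_iff)
  then show ?thesis
    by (simp add: power2_eq_iff_nonneg)
qed

lemma norm_add_square: "(norm (x + y))\<^sup>2 = (norm x)\<^sup>2 + (norm y)\<^sup>2 + 2 * Re (cinner x y)"
  for x y :: "'a::complex_inner"
proof -
  have "Re (cinner (x + y) (x + y)) = Re (cinner x x) + Re (cinner y y) + (Re (cinner x y) + Re (cinner y x))"
    by (simp add: cinner_add_left cinner_add_right)
  moreover have "Re (cinner y x) = Re (cinner x y)"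
    by (subst cinner_commute) simp
  ultimately show ?thesis
    by (simp add: cinner_self)
qed

text \<open>The class already supplies the triangle inequality; squaring it bounds the real part,
  and a unimodular factor rotates the inner product onto the positive axis.\<close>

lemma Cauchy_Schwarz_cinner: "cmod (cinner x y) \<le> norm x * norm y"
  for x y :: "'a::complex_inner"
proof -
  have re: "Re (cinner u y) \<le> norm u * norm y" for u :: 'a
  proof -
    have "(norm (u + y))\<^sup>2 \<le> (norm u + norm y)\<^sup>2"
      by (intro power_mono norm_triangle_ineq norm_ge_zero)
    then show ?thesis
      unfolding norm_add_square by (simp add: power2_sum)
  qed
  show ?thesis
  proof (cases "cinner x y = 0")
    case False
    define a where "a = cnj (cinner x y) / cmod (cinner x y)"
    have "cmod a = 1"
      using False by (simp add: a_def norm_divide)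
    moreover have "cinner (a *\<^sub>C x) y = complex_of_real (cmod (cinner x y))"
      using False unfolding cinner_scaleC_left a_def
      by (simp add: field_simps complex_norm_square[symmetric] power2_eq_square)
    ultimately show ?thesis
      using re[of "a *\<^sub>C x"] by (simp add: norm_scaleC)
  qed simp
qed

interpretation cinner: bounded_bilinear "cinner :: 'a::complex_inner \<Rightarrow> 'a \<Rightarrow> complex"
proof
  show "\<exists>K. \<forall>a b::'a. norm (cinner a b) \<le> norm a * norm b * K"
    by (auto intro!: exI[of _ 1] Cauchy_Schwarz_cinner)
qed (simp_all add: cinner_add_left cinner_add_right scaleR_scaleC cinner_scaleC_left
    cinner_scaleC_right scaleR_conv_of_real)

lemma bounded_linear_scaleC: "bounded_linear (\<lambda>x::'a::complex_inner. a *\<^sub>C x)"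
  by (rule bounded_linear_intro[of _ "cmod a"])
    (simp_all add: scaleC_add_right scaleR_scaleC scaleC_scaleC norm_scaleC mult.commute)

lemmas tendsto_scaleC = bounded_linear.tendsto[OF bounded_linear_scaleC]
lemmas scaleC_zero_right = linear_0[OF bounded_linear.linear[OF bounded_linear_scaleC]]

lemma scaleC_minus_one: "(-1) *\<^sub>C x = - x"
  for x :: "'a::complex_inner"
  using scaleR_scaleC[of "-1" x] by simp

lemma cinner_ext:
  fixes x y :: "'a::complex_inner"
  assumes "\<And>z. cinner x z = cinner y z"
  shows "x = y"
proof -
  have "cinner (x - y) (x - y) = 0"
    using assms by (simp add: cinner.diff_left)
  then show ?thesis
    by (simp add: cinner_self_eq_0)
qed

lemma cinner_ext_right:
  fixes x y :: "'a::complex_inner"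
  assumes "\<And>z. cinner z x = cinner z y"
  shows "x = y"
  using assms by (metis cinner_commute cinner_ext)

subsection \<open>Orthogonal projections and the Riesz representation\<close>

definition closed_csubspace :: "'a::complex_inner set \<Rightarrow> bool" where
  "closed_csubspace M \<longleftrightarrow> 0 \<in> M \<and> (\<forall>x\<in>M. \<forall>y\<in>M. x + y \<in> M) \<and> (\<forall>a. \<forall>x\<in>M. a *\<^sub>C x \<in> M) \<and> closed M"

lemma closed_csubspace_diff: "closed_csubspace M \<Longrightarrow> x \<in> M \<Longrightarrow> y \<in> M \<Longrightarrow> x - y \<in> M"
  unfolding closed_csubspace_def by (metis add_uminus_conv_diff scaleC_minus_one)

text \<open>The midpoint of two near-minimizers lies in \<open>M\<close>, so its distance to
  \<open>x\<close> is at least the infimum; the parallelogram law then forces a minimizing sequence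
  to be Cauchy.\<close>

lemma closest_point_closed_csubspace:
  fixes M :: "'a::chilbert set"
  assumes M: "closed_csubspace M"
  shows "\<exists>y\<in>M. \<forall>z\<in>M. norm (x - y) \<le> norm (x - z)"
proof -
  define d where "d = (INF z\<in>M. norm (x - z))"
  have ne: "M \<noteq> {}" and cl: "closed M"
    using M by (auto simp: closed_csubspace_def)
  have bdd: "bdd_below ((\<lambda>z. norm (x - z)) ` M)"
    by (rule bdd_belowI[of _ 0]) auto
  have d_le: "d \<le> norm (x - z)" if "z \<in> M" for z
    unfolding d_def using bdd that by (rule cINF_lower)
  have d0: "0 \<le> d"
    unfolding d_def using ne by (intro cINF_greatest) auto
  have "\<exists>z\<in>M. (norm (x - z))\<^sup>2 < d\<^sup>2 + inverse (real (Suc n))" for n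
  proof -
    have "d < sqrt (d\<^sup>2 + inverse (real (Suc n)))"
      by (rule real_less_rsqrt) simp
    then obtain z where "z \<in> M" "norm (x - z) < sqrt (d\<^sup>2 + inverse (real (Suc n)))"
      using cINF_less_iff[OF ne bdd] unfolding d_def[symmetric] by blast
    then show ?thesis
using power_strict_mono[of "norm (x - z)" "sqrt (d\<^sup>2 + inverse (real (Suc n)))" 2] by auto
  qed
  then obtain f where fM: "\<And>n. f n \<in> M" and f: "\<And>n. (norm (x - f n))\<^sup>2 < d\<^sup>2 + inverse (real (Suc n))"
    by metis
  have par: "(norm (f m - f n))\<^sup>2 \<le> 2 * (inverse (real (Suc m)) + inverse (real (Suc n)))" for m n
  proof -
    define w where "w = (1/2) *\<^sub>R (f m + f n)"
    have "w \<in> M"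
      unfolding w_def scaleR_scaleC using M fM unfolding closed_csubspace_def by blast
    then have dw: "d\<^sup>2 \<le> (norm (x - w))\<^sup>2"
      using d_le d0 by (intro power_mono)
    have 1: "(x - f m) + (x - f n) = 2 *\<^sub>R (x - w)"
      by (simp add: w_def scaleR_right_diff_distrib scaleR_2 algebra_simps)
    have 2: "(x - f n) - (x - f m) = f m - f n"
      by simp
    have "(norm ((x - f m) + (x - f n)))\<^sup>2 + (norm ((x - f n) - (x - f m)))\<^sup>2
        = 2 * (norm (x - f m))\<^sup>2 + 2 * (norm (x - f n))\<^sup>2"
      using norm_add_square[of "x - f m" "x - f n"] norm_add_square[of "x - f n" "- (x - f m)"]
        cinner_commute[of "x - f n" "x - f m"] norm_minus_cancel[of "x - f m"]
      by (simp only: cinner.minus_right diff_conv_add_uminus) simp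
    then have "4 * (norm (x - w))\<^sup>2 + (norm (f m - f n))\<^sup>2
        = 2 * (norm (x - f m))\<^sup>2 + 2 * (norm (x - f n))\<^sup>2"
      unfolding 1 2 by (simp add: power_mult_distrib)
    then show ?thesis
      using dw f[of m] f[of n] by argo
  qed
  have "Cauchy f"
  proof (rule metric_CauchyI)
    fix e :: real assume e: "0 < e"
    then have "0 < e\<^sup>2 / 4" by simp
    then obtain k where k: "inverse (real (Suc k)) < e\<^sup>2 / 4"
      using reals_Archimedean by blast
    show "\<exists>K. \<forall>m\<ge>K. \<forall>n\<ge>K. dist (f m) (f n) < e"
    proof (intro exI allI impI)
      fix m n assume mn: "k \<le> m" "k \<le> n"
      have "inverse (real (Suc m)) \<le> inverse (real (Suc k))" "inverse (real (Suc n)) \<le> inverse (real (Suc k))"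
        using mn by (auto intro!: le_imp_inverse_le)
      then have "(norm (f m - f n))\<^sup>2 < e\<^sup>2"
        using par[of m n] k by argo
      then show "dist (f m) (f n) < e"
        using e by (simp add: dist_norm power_less_imp_less_base)
    qed
  qed
  then obtain y where y: "f \<longlonglongrightarrow> y"
    using Cauchy_convergent convergent_def by blast
  have yM: "y \<in> M"
    using cl fM y closed_sequentially by blast
  have "(\<lambda>n. (norm (x - f n))\<^sup>2) \<longlonglongrightarrow> (norm (x - y))\<^sup>2"
    by (intro tendsto_intros y)
  moreover have "(\<lambda>n. d\<^sup>2 + inverse (real (Suc n))) \<longlonglongrightarrow> d\<^sup>2 + 0"
    by (intro tendsto_intros LIMSEQ_inverse_real_of_nat)
  ultimately have "(norm (x - y))\<^sup>2 \<le> d\<^sup>2 + 0"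
    using f by (intro LIMSEQ_le) (auto intro: less_imp_le)
  then have "norm (x - y) \<le> d"
    by (simp add: power2_le_iff_abs_le d0)
  then show ?thesis
    using yM d_le order_trans by blast
qed

lemma orthogonal_decomposition:
  fixes M :: "'a::chilbert set"
  assumes M: "closed_csubspace M"
  shows "\<exists>y\<in>M. \<forall>z\<in>M. cinner (x - y) z = 0"
proof -
  obtain y where y: "y \<in> M" and min: "\<And>z. z \<in> M \<Longrightarrow> norm (x - y) \<le> norm (x - z)"
    using closest_point_closed_csubspace[OF M] by blast
  have "cinner (x - y) z = 0" if z: "z \<in> M" for z
  proof (cases "z = 0")
    case False
    define c where "c = cinner (x - y) z"
    \<comment> \<open>\<open>a *\<^sub>C z\<close> is the component of \<open>x - y\<close> along
      \<open>z\<close>; adding it to \<open>y\<close> would lower the squared distance by |c|^2 /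
      |z|^2.\<close>
    define a where "a = c / complex_of_real ((norm z)\<^sup>2)"
    have "y + a *\<^sub>C z \<in> M"
      using M y z by (auto simp: closed_csubspace_def)
    from min[OF this] have "norm (x - y) \<le> norm ((x - y) + - (a *\<^sub>C z))"
      by (simp add: diff_diff_eq)
    then have "(norm (x - y))\<^sup>2 \<le> (norm ((x - y) + - (a *\<^sub>C z)))\<^sup>2"
      by (intro power_mono) auto
    also have "\<dots> = (norm (x - y))\<^sup>2 + (cmod a * norm z)\<^sup>2 - 2 * Re (cnj a * c)"
      unfolding norm_add_square
      by (simp add: cinner.minus_right cinner_scaleC_right norm_scaleC c_def)
    also have "Re (cnj a * c) = (cmod c)\<^sup>2 / (norm z)\<^sup>2"
    proof -
      have "cnj a * c = complex_of_real ((cmod c)\<^sup>2 / (norm z)\<^sup>2)"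
        by (simp add: a_def complex_norm_square[of c, symmetric] mult.commute[of "cnj c"] flip: of_real_power)
      then show ?thesis by (simp only: Re_complex_of_real)
    qed
    also have "(cmod a * norm z)\<^sup>2 = (cmod c)\<^sup>2 / (norm z)\<^sup>2"
      using False unfolding a_def norm_divide norm_of_real by (simp add: field_simps power2_eq_square)
    finally have "(cmod c)\<^sup>2 / (norm z)\<^sup>2 \<le> 0"
      by simp
    then show ?thesis
      using False by (simp add: c_def divide_le_0_iff)
  qed (simp add: cinner.zero_right)
  then show ?thesis
    using y by blast
qed

lemma Riesz_representation:
  fixes f :: "'a::chilbert \<Rightarrow> complex"
  assumes add: "\<And>x y. f (x + y) = f x + f y" and scale: "\<And>a x. f (a *\<^sub>C x) = a * f x"
    and bound: "\<And>x. cmod (f x) \<le> C * norm x"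
  shows "\<exists>z. \<forall>x. f x = cinner x z"
proof (cases "\<forall>x. f x = 0")
  case True
  then show ?thesis
    by (intro exI[of _ 0]) (simp add: cinner.zero_right)
next
  case False
  then obtain x0 where x0: "f x0 \<noteq> 0" by blast
  have bl: "bounded_linear f"
    by (rule bounded_linear_intro[of _ C])
      (use bound in \<open>simp_all add: add scale scaleR_scaleC scaleR_conv_of_real mult.commute\<close>)
  have diff: "f (x - y) = f x - f y" for x y
    using bl by (simp add: bounded_linear.linear linear_diff)
  have "closed {x. f x = 0}"
    using closed_Collect_eq[OF linear_continuous_on[OF bl] continuous_on_const] .
  then have M: "closed_csubspace {x. f x = 0}"
    using bl by (auto simp: closed_csubspace_def add scale bounded_linear.linear linear_0)
  obtain p where p: "f p = 0" and orth: "\<And>z. f z = 0 \<Longrightarrow> cinner (x0 - p) z = 0"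
    using orthogonal_decomposition[OF M] by blast
  define w where "w = x0 - p"
  have fw: "f w \<noteq> 0"
    using x0 p by (simp add: w_def diff)
  then have w0: "w \<noteq> 0"
    using bl by (auto simp: bounded_linear.linear linear_0)
  have "f x = cinner x ((cnj (f w) / complex_of_real ((norm w)\<^sup>2)) *\<^sub>C w)" for x
  proof -
    \<comment> \<open>This combination lies in the kernel of \<open>f\<close>, to which
      \<open>w\<close> is orthogonal; solving for \<open>f x\<close> gives the representing
      vector.\<close>
    have "cinner w (f w *\<^sub>C x - f x *\<^sub>C w) = 0"
      unfolding w_def by (rule orth) (simp add: diff scale)
    then have "cinner (f w *\<^sub>C x - f x *\<^sub>C w) w = 0"
      by (metis cinner_commute complex_cnj_zero)
    then have "f w * cinner x w = f x * complex_of_real ((norm w)\<^sup>2)"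
      by (simp add: cinner.diff_left cinner_scaleC_left cinner_self)
    then show ?thesis
      using w0 by (simp add: cinner_scaleC_right field_simps)
  qed
  then show ?thesis by blast
qed

subsection \<open>Bounded operators and adjoints\<close>

lemma bounded_op_add: "bounded_op T \<Longrightarrow> T (x + y) = T x + T y"
  and bounded_op_scaleC: "bounded_op T \<Longrightarrow> T (a *\<^sub>C x) = a *\<^sub>C T x"
  by (simp_all add: bounded_op_def clinear_op_def)

lemma bounded_op_scaleR: "bounded_op T \<Longrightarrow> T (r *\<^sub>R x) = r *\<^sub>R T x"
  by (simp add: scaleR_scaleC bounded_op_scaleC)

lemma bounded_op_bound:
  assumes "bounded_op T"
  obtains C where "0 < C" "\<And>x. norm (T x) \<le> C * norm x"
proof -
  obtain C where C: "\<And>x. norm (T x) \<le> C * norm x"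
    using assms by (auto simp: bounded_op_def)
  show thesis
  proof (rule that[of "\<bar>C\<bar> + 1"])
    show "norm (T x) \<le> (\<bar>C\<bar> + 1) * norm x" for x
      by (rule order_trans[OF C]) (intro mult_right_mono, auto)
  qed simp
qed

lemma bounded_op_bounded_linear:
  assumes "bounded_op T"
  shows "bounded_linear T"
proof -
  obtain C where "0 < C" "\<And>x. norm (T x) \<le> C * norm x"
    using bounded_op_bound[OF assms] by blast
  then show ?thesis
    by (intro bounded_linear_intro[of _ C])
      (simp_all add: bounded_op_add[OF assms] bounded_op_scaleR[OF assms] mult.commute)
qed

lemma bounded_op_diff: "bounded_op T \<Longrightarrow> T (x - y) = T x - T y"
  by (simp add: bounded_op_bounded_linear bounded_linear.linear linear_diff)

lemma bounded_op_zero: "bounded_op T \<Longrightarrow> T 0 = 0"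
  by (simp add: bounded_op_bounded_linear bounded_linear.linear linear_0)

lemmas bounded_op_linear = bounded_op_add bounded_op_diff bounded_op_zero bounded_op_scaleC bounded_op_scaleR

lemma bounded_opI:
  assumes "\<And>x y. T (x + y) = T x + T y" "\<And>a x. T (a *\<^sub>C x) = a *\<^sub>C T x"
    and "\<And>x. norm (T x) \<le> C * norm x"
  shows "bounded_op T"
  using assms by (auto simp: bounded_op_def clinear_op_def)

lemma bounded_op_tendsto: "bounded_op T \<Longrightarrow> (f \<longlongrightarrow> l) F \<Longrightarrow> ((\<lambda>i. T (f i)) \<longlongrightarrow> T l) F"
  using bounded_linear.tendsto bounded_op_bounded_linear by blast

lemma bounded_op_ident: "bounded_op (\<lambda>x. x)"
  by (rule bounded_opI[of _ 1]) auto

lemma bounded_op_compose: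
  assumes S: "bounded_op S" and T: "bounded_op T"
  shows "bounded_op (\<lambda>x. S (T x))"
proof -
  obtain c where c: "0 < c" "\<And>x. norm (S x) \<le> c * norm x"
    using bounded_op_bound[OF S] by blast
  obtain d where d: "0 < d" "\<And>x. norm (T x) \<le> d * norm x"
    using bounded_op_bound[OF T] by blast
  have "norm (S (T x)) \<le> (c * d) * norm x" for x
    using c(2)[of "T x"] mult_left_mono[OF d(2)[of x], of c] c(1) by (simp add: mult.assoc order_trans)
  then show ?thesis
    by (intro bounded_opI[of _ "c * d"]) (simp_all add: bounded_op_linear[OF S] bounded_op_linear[OF T])
qed

lemma bounded_op_plus:
  assumes S: "bounded_op S" and T: "bounded_op T"
  shows "bounded_op (\<lambda>x. S x + T x)"
proof -
  obtain c where c: "0 < c" "\<And>x. norm (S x) \<le> c * norm x"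
    using bounded_op_bound[OF S] by blast
  obtain d where d: "0 < d" "\<And>x. norm (T x) \<le> d * norm x"
    using bounded_op_bound[OF T] by blast
  have "norm (S x + T x) \<le> (c + d) * norm x" for x
    using c(2)[of x] d(2)[of x] norm_triangle_ineq[of "S x" "T x"] by (simp add: distrib_right)
  then show ?thesis
    by (intro bounded_opI[of _ "c + d"])
      (simp_all add: bounded_op_linear[OF S] bounded_op_linear[OF T] scaleC_add_right)
qed

lemma bounded_op_scale:
  assumes S: "bounded_op S"
  shows "bounded_op (\<lambda>x. r *\<^sub>R S x)"
proof -
  have "bounded_op (\<lambda>x::'a. r *\<^sub>R x)"
    by (rule bounded_opI[of _ "\<bar>r\<bar>"])
      (simp_all add: scaleC_add_right scaleR_scaleC scaleC_scaleC norm_scaleC mult.commute)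
  from bounded_op_compose[OF this S] show ?thesis .
qed

lemma bounded_op_minus: "bounded_op S \<Longrightarrow> bounded_op T \<Longrightarrow> bounded_op (\<lambda>x. S x - T x)"
  using bounded_op_plus[of S "\<lambda>x. (-1) *\<^sub>R T x"] bounded_op_scale[of T "-1"] by simp

lemmas bounded_op_intros = bounded_op_ident bounded_op_plus bounded_op_minus bounded_op_scale

text \<open>Riesz representation provides a witness for the choice in \<open>cadj\<close>; every
  later fact about adjoints rests on this identity.\<close>

lemma cinner_cadj:
  fixes T :: "'a::chilbert \<Rightarrow> 'a"
  assumes T: "bounded_op T"
  shows "cinner (T x) y = cinner x (cadj T y)"
proof -
  obtain C where C: "0 < C" "\<And>x. norm (T x) \<le> C * norm x"
    using bounded_op_bound[OF T] by blast
  have "\<exists>z. \<forall>x. cinner (T x) y = cinner x z" for y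
  proof (rule Riesz_representation[where C = "C * norm y"])
    show "cmod (cinner (T x) y) \<le> C * norm y * norm x" for x
      using Cauchy_Schwarz_cinner[of "T x" y] mult_right_mono[OF C(2)[of x], of "norm y"]
      by (simp add: mult_ac)
  qed (simp_all add: bounded_op_linear[OF T] cinner_add_left cinner_scaleC_left)
  then have "\<exists>S. \<forall>x y. cinner (T x) y = cinner x (S y)"
    by metis
  then have "\<forall>x y. cinner (T x) y = cinner x (cadj T y)"
    unfolding cadj_def by (rule someI_ex)
  then show ?thesis by blast
qed

lemma cinner_cadj': "bounded_op T \<Longrightarrow> cinner (cadj T x) y = cinner x (T y)"
  for T :: "'a::chilbert \<Rightarrow> 'a"
  by (metis cinner_cadj cinner_commute)

lemma cadj_unique:
  fixes T :: "'a::chilbert \<Rightarrow> 'a"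
  assumes "bounded_op T" and "\<And>x y. cinner (T x) y = cinner x (S y)"
  shows "cadj T = S"
  using assms by (metis cinner_cadj cinner_ext_right ext)

lemma bounded_op_cadj:
  fixes T :: "'a::chilbert \<Rightarrow> 'a"
  assumes T: "bounded_op T"
  shows "bounded_op (cadj T)"
proof -
  obtain C where C: "0 < C" "\<And>x. norm (T x) \<le> C * norm x"
    using bounded_op_bound[OF T] by blast
  show ?thesis
  proof (rule bounded_opI)
    show "cadj T (x + y) = cadj T x + cadj T y" for x y
      by (rule cinner_ext) (simp add: cinner_cadj'[OF T] cinner_add_left)
    show "cadj T (a *\<^sub>C x) = a *\<^sub>C cadj T x" for a x
      by (rule cinner_ext) (simp add: cinner_cadj'[OF T] cinner_scaleC_left)
    show "norm (cadj T x) \<le> C * norm x" for x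
    proof -
      have "(norm (cadj T x))\<^sup>2 = cmod (cinner (cadj T x) (cadj T x))"
        by (simp add: cinner_self norm_power)
      also have "\<dots> \<le> norm x * norm (T (cadj T x))"
        unfolding cinner_cadj'[OF T] by (rule Cauchy_Schwarz_cinner)
      also have "\<dots> \<le> norm x * (C * norm (cadj T x))"
        by (intro mult_left_mono C) auto
      finally show ?thesis
        using C(1) by (cases "norm (cadj T x) = 0") (simp_all add: power2_eq_square mult_ac)
    qed
  qed
qed

subsection \<open>Positive operators\<close>

text \<open>Polarization: reality of the form at \<open>x + y\<close> and at
  \<open>x + \<i> *\<^sub>C y\<close> gives two linear equations for the off-diagonal terms.\<close>

lemma self_adjoint_if_real_form:
  fixes A :: "'a::complex_inner \<Rightarrow> 'a"
  assumes A: "bounded_op A" and real: "\<And>x. Im (cinner (A x) x) = 0"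
  shows "cinner (A x) y = cinner x (A y)"
proof -
  have q: "cinner (A z) z = cinner z (A z)" for z
    using real[of z] cinner_commute[of z "A z"] by (simp add: complex_eq_iff)
  note expand = bounded_op_linear[OF A] cinner_add_left cinner_add_right cinner_scaleC_left cinner_scaleC_right
  have 1: "cinner (A x) y + cinner (A y) x = cinner x (A y) + cinner y (A x)"
    using q[of "x + y"] q[of x] q[of y] by (simp add: expand add.commute)
  have "\<i> * (cinner (A y) x - cinner (A x) y) = \<i> * (cinner y (A x) - cinner x (A y))"
    using q[of "x + \<i> *\<^sub>C y"] q[of x] q[of y] by (simp add: expand algebra_simps)
  then have 2: "cinner (A y) x - cinner (A x) y = cinner y (A x) - cinner x (A y)"
    by simp
  have "2 * cinner (A x) y = 2 * cinner x (A y)"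
    using 1 2 by algebra
  then show ?thesis by simp
qed

lemma positive_op_bounded: "positive_op A \<Longrightarrow> bounded_op A"
  by (simp add: positive_op_def)

lemma positive_op_self_adjoint: "positive_op A \<Longrightarrow> cinner (A x) y = cinner x (A y)"
  unfolding positive_op_def by (blast intro: self_adjoint_if_real_form)

lemma positive_opI:
  fixes A :: "'a::complex_inner \<Rightarrow> 'a"
  assumes "bounded_op A" "\<And>x y. cinner (A x) y = cinner x (A y)" "\<And>x. 0 \<le> Re (cinner (A x) x)"
  shows "positive_op A"
proof -
  have "Im (cinner (A x) x) = 0" for x
    using assms(2)[of x x] cinner_commute[of x "A x"] by (metis complex_cnj_cancel_iff Im_complex_of_real Reals_cases Reals_cnj_iff)
  then show ?thesis
    using assms by (simp add: positive_op_def)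
qed

lemma norm_diff_square: "(norm (x - y))\<^sup>2 = (norm x)\<^sup>2 + (norm y)\<^sup>2 - 2 * Re (cinner x y)"
  for x y :: "'a::complex_inner"
  using norm_add_square[of x "- y"] by (simp add: cinner.minus_right)

text \<open>Nonnegativity of the form of \<open>A\<close> at \<open>x - t A x\<close> with \<open>t = 1/k\<close>.\<close>

lemma positive_op_norm_square_le:
  fixes A :: "'a::complex_inner \<Rightarrow> 'a"
  assumes A: "positive_op A" and k: "0 < k" "\<And>x. norm (A x) \<le> k * norm x"
  shows "(norm (A x))\<^sup>2 \<le> k * Re (cinner (A x) x)"
proof -
  note lin = bounded_op_linear[OF positive_op_bounded[OF A]]
  define y where "y = A x"
  define t where "t = 1 / k"
  have "Re (cinner (A y) y) \<le> norm (A y) * norm y"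
    using Cauchy_Schwarz_cinner[of "A y" y] complex_Re_le_cmod order_trans by blast
  also have "\<dots> \<le> k * (norm y)\<^sup>2"
    using mult_right_mono[OF k(2)[of y], of "norm y"] by (simp add: power2_eq_square mult.assoc)
  finally have yy: "Re (cinner (A y) y) \<le> k * (norm y)\<^sup>2" .
  have sym: "cinner (A y) x = cinner y y"
    using positive_op_self_adjoint[OF A, of y x] by (simp add: y_def)
  have "0 \<le> Re (cinner (A (x - t *\<^sub>R y)) (x - t *\<^sub>R y))"
    using A by (simp add: positive_op_def)
  also have "\<dots> = Re (cinner y x) - 2 * t * (norm y)\<^sup>2 + t\<^sup>2 * Re (cinner (A y) y)"
    by (simp add: lin y_def[symmetric] cinner.diff_left cinner.diff_right cinner.scaleR_left
        cinner.scaleR_right sym cinner_self algebra_simps power2_eq_square)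
  also have "\<dots> \<le> Re (cinner y x) - 2 * t * (norm y)\<^sup>2 + t\<^sup>2 * (k * (norm y)\<^sup>2)"
    using yy by (intro add_left_mono mult_left_mono) auto
  also have "\<dots> = Re (cinner y x) - (norm y)\<^sup>2 / k"
    using k(1) by (simp add: t_def field_simps power2_eq_square)
  finally show ?thesis
    using k(1) by (simp add: y_def field_simps)
qed

lemma positive_op_eq_0:
  fixes A :: "'a::complex_inner \<Rightarrow> 'a"
  assumes A: "positive_op A" and "Re (cinner (A x) x) = 0"
  shows "A x = 0"
proof -
  obtain k where "0 < k" "\<And>x. norm (A x) \<le> k * norm x"
    using bounded_op_bound[OF positive_op_bounded[OF A]] by blast
  from positive_op_norm_square_le[OF A this, of x] show ?thesis
    using assms(2) by simp
qed

subsection \<open>Square roots of positive operators\<close>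

text \<open>The iteration \<open>Y \<mapsto> (B + Y\<^sup>2) / 2\<close> converges to \<open>I - sqrt (I - B)\<close> for a contraction \<open>B\<close>;
  the same iteration for the number \<open>1\<close> majorizes its increments.\<close>

primrec sqrt_iter :: "('a::real_vector \<Rightarrow> 'a) \<Rightarrow> nat \<Rightarrow> 'a \<Rightarrow> 'a" where
  "sqrt_iter B 0 = (\<lambda>x. 0)"
| "sqrt_iter B (Suc n) = (\<lambda>x. (1/2) *\<^sub>R (B x + sqrt_iter B n (sqrt_iter B n x)))"

primrec sqrt_majorant :: "nat \<Rightarrow> real" where
  "sqrt_majorant 0 = 0"
| "sqrt_majorant (Suc n) = (1 + (sqrt_majorant n)\<^sup>2) / 2"

lemma sqrt_majorant_bounds: "0 \<le> sqrt_majorant n" "sqrt_majorant n \<le> 1"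
proof -
  have "0 \<le> sqrt_majorant n \<and> sqrt_majorant n \<le> 1"
    by (induction n) (auto simp: power_le_one)
  then show "0 \<le> sqrt_majorant n" "sqrt_majorant n \<le> 1" by auto
qed

lemma Cauchy_sqrt_majorant: "Cauchy sqrt_majorant"
proof (rule convergent_Cauchy, rule Bseq_mono_convergent)
  show "Bseq sqrt_majorant"
    by (rule BseqI'[of _ 1]) (use sqrt_majorant_bounds in auto)
  \<comment> \<open>The increment equals (1 - m)^2 / 2 for the current value m.\<close>
  have "sqrt_majorant n \<le> sqrt_majorant (Suc n)" for n
    using zero_le_power2[of "1 - sqrt_majorant n"] by (simp add: power2_diff field_simps)
  then show "\<forall>m n. m \<le> n \<longrightarrow> sqrt_majorant m \<le> sqrt_majorant n"
    by (auto intro: lift_Suc_mono_le)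
qed

lemma bounded_op_sqrt_iter: "bounded_op B \<Longrightarrow> bounded_op (sqrt_iter B n)"
proof (induction n)
  case 0
  then show ?case
    by (auto intro!: bounded_opI[of _ 0] simp: scaleC_zero_right)
next
  case (Suc n)
  then show ?case
    using bounded_op_compose[of "sqrt_iter B n" "sqrt_iter B n"]
    by (simp add: bounded_op_plus bounded_op_scale)
qed

lemma sqrt_iter_commute:
  assumes S: "bounded_op S" and SB: "\<And>x. S (B x) = B (S x)"
  shows "S (sqrt_iter B n x) = sqrt_iter B n (S x)"
  by (induction n arbitrary: x) (simp_all add: SB bounded_op_linear[OF S])

lemma sqrt_iter_self_adjoint:
  fixes B :: "'a::complex_inner \<Rightarrow> 'a"
  assumes "\<And>x y. cinner (B x) y = cinner x (B y)"
  shows "cinner (sqrt_iter B n x) y = cinner x (sqrt_iter B n y)"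
  by (induction n arbitrary: x y)
    (simp_all add: assms cinner_add_left cinner_add_right cinner.scaleR_left cinner.scaleR_right
      cinner.zero_left cinner.zero_right)

lemma norm_sqrt_iter_le:
  fixes B :: "'a::complex_inner \<Rightarrow> 'a"
  assumes B: "\<And>x. norm (B x) \<le> norm x"
  shows "norm (sqrt_iter B n x) \<le> sqrt_majorant n * norm x"
proof (induction n arbitrary: x)
  case (Suc n)
  have "norm (sqrt_iter B n (sqrt_iter B n x)) \<le> sqrt_majorant n * (sqrt_majorant n * norm x)"
    using Suc[of "sqrt_iter B n x"] mult_left_mono[OF Suc[of x] sqrt_majorant_bounds(1)[of n]] by linarith
  then have "norm (B x + sqrt_iter B n (sqrt_iter B n x)) \<le> norm x + sqrt_majorant n * (sqrt_majorant n * norm x)"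
    using norm_triangle_ineq[of "B x" "sqrt_iter B n (sqrt_iter B n x)"] B[of x] by linarith
  then show ?case
    by (simp add: power2_eq_square distrib_right mult.assoc del: scaleR_add_right)
qed simp

text \<open>Since the iterates commute, the difference of their squares factors as (Z + Y)(Z - Y).
  The scalar recursion factors in the same way, so each operator increment stays below the scalar
  one.\<close>

lemma norm_sqrt_iter_Suc_diff_le:
  fixes B :: "'a::complex_inner \<Rightarrow> 'a"
  assumes B: "bounded_op B" "\<And>x. norm (B x) \<le> norm x"
  shows "norm (sqrt_iter B (Suc n) x - sqrt_iter B n x) \<le> (sqrt_majorant (Suc n) - sqrt_majorant n) * norm x"
proof (induction n)
  case 0
  then show ?case using B(2)[of x] by (simp add: field_simps)
next
  case (Suc n)
  let ?Y = "sqrt_iter B n" and ?Z = "sqrt_iter B (Suc n)"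
  define d where "d = ?Z x - ?Y x"
  note Y = bounded_op_sqrt_iter[OF B(1), of n] and Z = bounded_op_sqrt_iter[OF B(1), of "Suc n"]
  have "?Z (?Y x) = ?Y (?Z x)"
    by (rule sqrt_iter_commute[OF Z, where B = B])
      (rule sqrt_iter_commute[symmetric, OF B(1)], simp)
  then have "sqrt_iter B (Suc (Suc n)) x - ?Z x = (1/2) *\<^sub>R (?Z d + ?Y d)"
    unfolding d_def bounded_op_diff[OF Y] bounded_op_diff[OF Z]
    by (simp only: sqrt_iter.simps(2)[of B "Suc n"]) (simp add: algebra_simps)
  moreover have "norm (?Z d) + norm (?Y d) \<le> (sqrt_majorant (Suc n) + sqrt_majorant n) * norm d"
    using norm_sqrt_iter_le[OF B(2), of n d] norm_sqrt_iter_le[OF B(2), of "Suc n" d]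
    by (simp only: distrib_right)
  moreover have "\<dots> \<le> (sqrt_majorant (Suc n) + sqrt_majorant n) * ((sqrt_majorant (Suc n) - sqrt_majorant n) * norm x)"
    unfolding d_def using sqrt_majorant_bounds(1)[of n] sqrt_majorant_bounds(1)[of "Suc n"]
    by (intro mult_left_mono Suc) simp
  moreover have "(sqrt_majorant (Suc n) + sqrt_majorant n) * ((sqrt_majorant (Suc n) - sqrt_majorant n) * norm x)
      = 2 * ((sqrt_majorant (Suc (Suc n)) - sqrt_majorant (Suc n)) * norm x)"
    unfolding sqrt_majorant.simps(2)[of "Suc n"] using sqrt_majorant.simps(2)[of n] by algebra
  ultimately show ?case
    using norm_triangle_ineq[of "?Z d" "?Y d"] by (simp del: sqrt_iter.simps sqrt_majorant.simps)
qed

lemma norm_sqrt_iter_diff_le: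
  fixes B :: "'a::complex_inner \<Rightarrow> 'a"
  assumes B: "bounded_op B" "\<And>x. norm (B x) \<le> norm x" and "n \<le> m"
  shows "norm (sqrt_iter B m x - sqrt_iter B n x) \<le> (sqrt_majorant m - sqrt_majorant n) * norm x"
  using \<open>n \<le> m\<close>
proof (induction m rule: dec_induct)
  case (step m)
  have "norm (sqrt_iter B (Suc m) x - sqrt_iter B n x)
      \<le> norm (sqrt_iter B (Suc m) x - sqrt_iter B m x) + norm (sqrt_iter B m x - sqrt_iter B n x)"
    by norm
  then show ?case
    using step(3) norm_sqrt_iter_Suc_diff_le[OF B, of m x] by (simp only: left_diff_distrib)
qed simp

lemma convergent_sqrt_iter:
  fixes B :: "'a::chilbert \<Rightarrow> 'a"
  assumes B: "bounded_op B" "\<And>x. norm (B x) \<le> norm x"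
  shows "convergent (\<lambda>n. sqrt_iter B n x)"
proof (rule Cauchy_convergent, rule metric_CauchyI)
  fix e :: real assume "0 < e"
  \<comment> \<open>Adding 1 keeps the denominator positive when \<open>x = 0\<close>.\<close>
  then have "0 < e / (norm x + 1)"
    by (simp add: add_nonneg_pos)
  then obtain N where N: "\<And>m n. N \<le> m \<Longrightarrow> N \<le> n \<Longrightarrow> dist (sqrt_majorant m) (sqrt_majorant n) < e / (norm x + 1)"
    using metric_CauchyD[OF Cauchy_sqrt_majorant] by blast
  have le: "dist (sqrt_iter B m x) (sqrt_iter B n x) < e" if "N \<le> n" "n \<le> m" for m n
  proof -
    have "dist (sqrt_iter B m x) (sqrt_iter B n x) \<le> dist (sqrt_majorant m) (sqrt_majorant n) * norm x"
      using norm_sqrt_iter_diff_le[OF B that(2), of x] unfolding dist_norm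
      by (rule order_trans) (intro mult_right_mono, auto)
    also have "\<dots> \<le> dist (sqrt_majorant m) (sqrt_majorant n) * (norm x + 1)"
      by (intro mult_left_mono) auto
    also have "\<dots> < e"
      using N[of m n] that by (simp add: pos_less_divide_eq add_nonneg_pos)
    finally show ?thesis .
  qed
  show "\<exists>M. \<forall>m\<ge>M. \<forall>n\<ge>M. dist (sqrt_iter B m x) (sqrt_iter B n x) < e"
  proof (intro exI allI impI)
    fix m n assume "N \<le> m" "N \<le> n"
    then show "dist (sqrt_iter B m x) (sqrt_iter B n x) < e"
      using le[of n m] le[of m n] by (cases "n \<le> m") (auto simp: dist_commute)
  qed
qed

text \<open>The fixed-point equation B + Y^2 = 2 Y for the limit of the iteration reads (I - Y)^2 =
  I - B, and commutation passes from the iterates to the limit. The clause about all commuting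
  \<open>S\<close> gives uniqueness of roots later.\<close>

lemma sqrt_of_identity_minus_contraction:
  fixes B :: "'a::chilbert \<Rightarrow> 'a"
  assumes B: "bounded_op B" "\<And>x. norm (B x) \<le> norm x" and sa: "\<And>x y. cinner (B x) y = cinner x (B y)"
  shows "\<exists>R. positive_op R \<and> (\<forall>x. R (R x) = x - B x)
    \<and> (\<forall>S. bounded_op S \<longrightarrow> (\<forall>x. S (B x) = B (S x)) \<longrightarrow> (\<forall>x. S (R x) = R (S x)))"
proof -
  let ?Y = "sqrt_iter B"
  define Y where "Y x = lim (\<lambda>n. ?Y n x)" for x
  have lim: "(\<lambda>n. ?Y n x) \<longlonglongrightarrow> Y x" for x
    unfolding Y_def using convergent_sqrt_iter[OF B] by (simp add: convergent_LIMSEQ_iff)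
  have contr: "norm (?Y n x) \<le> norm x" for n x
    using norm_sqrt_iter_le[OF B(2), of n x] mult_right_mono[OF sqrt_majorant_bounds(2)[of n], of "norm x"]
    by simp
  have Yn: "bounded_op (?Y n)" for n
    by (rule bounded_op_sqrt_iter[OF B(1)])
  have Y_le: "norm (Y x) \<le> norm x" for x
    using tendsto_norm[OF lim] by (rule tendsto_upperbound) (simp_all add: contr)
  have Y: "bounded_op Y"
  proof (rule bounded_opI[of _ 1])
    show "Y (x + y) = Y x + Y y" for x y
      using lim[of "x + y"] tendsto_add[OF lim[of x] lim[of y]]
      by (intro LIMSEQ_unique) (simp_all only: bounded_op_add[OF Yn])
    show "Y (a *\<^sub>C x) = a *\<^sub>C Y x" for a x
      using lim[of "a *\<^sub>C x"] tendsto_scaleC[OF lim[of x], of a]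
      by (intro LIMSEQ_unique) (simp_all only: bounded_op_scaleC[OF Yn])
  qed (simp add: Y_le)
  have Y_sa: "cinner (Y x) y = cinner x (Y y)" for x y
    using cinner.tendsto[OF lim[of x] tendsto_const[of y]] cinner.tendsto[OF tendsto_const[of x] lim[of y]]
    by (intro LIMSEQ_unique) (simp_all only: sqrt_iter_self_adjoint[OF sa])
  have YY: "B x + Y (Y x) = 2 *\<^sub>R Y x" for x
  proof -
    \<comment> \<open>Pointwise convergence does not by itself pass to squares; the uniform bound by
      contractions makes it do so.\<close>
    have "(\<lambda>n. ?Y n (?Y n x) - ?Y n (Y x)) \<longlonglongrightarrow> 0"
    proof (rule Lim_null_comparison)
      show "\<forall>\<^sub>F n in sequentially. norm (?Y n (?Y n x) - ?Y n (Y x)) \<le> norm (?Y n x - Y x)"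
        using contr by (simp add: bounded_op_diff[OF Yn, symmetric])
      show "(\<lambda>n. norm (?Y n x - Y x)) \<longlonglongrightarrow> 0"
        using lim[of x] by (simp add: LIM_zero_iff tendsto_norm_zero_iff)
    qed
    from tendsto_add[OF this lim[of "Y x"]] have "(\<lambda>n. ?Y n (?Y n x)) \<longlonglongrightarrow> Y (Y x)"
      by simp
    then have "(\<lambda>n. (1/2) *\<^sub>R (B x + ?Y n (?Y n x))) \<longlonglongrightarrow> (1/2) *\<^sub>R (B x + Y (Y x))"
      by (intro tendsto_intros)
    moreover have "(\<lambda>n. ?Y (Suc n) x) \<longlonglongrightarrow> Y x"
      using lim[of x] by (rule LIMSEQ_Suc)
    ultimately have "Y x = (1/2) *\<^sub>R (B x + Y (Y x))"
      by (intro LIMSEQ_unique) simp_all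
    then have "2 *\<^sub>R Y x = 2 *\<^sub>R ((1/2) *\<^sub>R (B x + Y (Y x)))"
      by (rule arg_cong)
    then show ?thesis by simp
  qed
  have "positive_op (\<lambda>x. x - Y x)"
  proof (rule positive_opI)
    show "0 \<le> Re (cinner (x - Y x) x)" for x
    proof -
      have "Re (cinner (Y x) x) \<le> norm (Y x) * norm x"
        using Cauchy_Schwarz_cinner[of "Y x" x] complex_Re_le_cmod order_trans by blast
      also have "\<dots> \<le> (norm x)\<^sup>2"
        using mult_right_mono[OF Y_le[of x], of "norm x"] by (simp add: power2_eq_square)
      finally show ?thesis
        by (simp add: cinner.diff_left cinner_self)
    qed
  qed (auto intro!: bounded_op_intros Y simp: cinner.diff_left cinner.diff_right Y_sa)
  moreover have "(x - Y x) - Y (x - Y x) = x - B x" for x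
    using YY[of x] by (simp add: bounded_op_diff[OF Y] scaleR_2 algebra_simps)
  moreover have "S (x - Y x) = S x - Y (S x)" if S: "bounded_op S" "\<And>x. S (B x) = B (S x)" for S x
  proof -
    have "S (Y x) = Y (S x)"
      using bounded_op_tendsto[OF S(1) lim[of x]] lim[of "S x"]
      by (intro LIMSEQ_unique) (simp_all only: sqrt_iter_commute[where B = B, OF S])
    then show ?thesis
      by (simp add: bounded_op_diff[OF S(1)])
  qed
  ultimately show ?thesis
    by (intro exI[of _ "\<lambda>x. x - Y x"]) auto
qed

lemma positive_sqrt_exists:
  fixes A :: "'a::chilbert \<Rightarrow> 'a"
  assumes A: "positive_op A"
  shows "\<exists>R. positive_op R \<and> (\<forall>x. R (R x) = A x)
    \<and> (\<forall>S. bounded_op S \<longrightarrow> (\<forall>x. S (A x) = A (S x)) \<longrightarrow> (\<forall>x. S (R x) = R (S x)))"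
proof -
  note bA = positive_op_bounded[OF A]
  obtain k where k: "0 < k" "\<And>x. norm (A x) \<le> k * norm x"
    using bounded_op_bound[OF bA] by blast
  \<comment> \<open>Scaling by a norm bound \<open>k\<close> puts \<open>A / k\<close> between 0 and
    I, so that \<open>B\<close> is a contraction; the factor \<open>sqrt k\<close> undoes the
    scaling at the end.\<close>
  define B where "B x = x - (1/k) *\<^sub>R A x" for x
  have bB: "bounded_op B"
    unfolding B_def by (intro bounded_op_intros bA)
  have "norm (B x) \<le> norm x" for x
  proof -
    have "(norm (B x))\<^sup>2 = (norm x)\<^sup>2 + ((norm (A x))\<^sup>2 - 2 * k * Re (cinner (A x) x)) / k\<^sup>2"
      using k(1) positive_op_self_adjoint[OF A, of x x]
      unfolding B_def norm_diff_square by (simp add: cinner.scaleR_right field_simps power2_eq_square)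
    also have "\<dots> \<le> (norm x)\<^sup>2"
    proof -
      have "0 \<le> k * Re (cinner (A x) x)"
        using k(1) A by (simp add: positive_op_def)
      then have "(norm (A x))\<^sup>2 - 2 * k * Re (cinner (A x) x) \<le> 0"
        using positive_op_norm_square_le[OF A k, of x] by linarith
      then show ?thesis
        by (simp add: divide_nonpos_nonneg)
    qed
    finally show ?thesis
      by (rule power2_le_imp_le) simp
  qed
  moreover have "cinner (B x) y = cinner x (B y)" for x y
    by (simp add: B_def cinner.diff_left cinner.diff_right cinner.scaleR_left cinner.scaleR_right
        positive_op_self_adjoint[OF A])
  ultimately obtain R where R: "positive_op R" "\<And>x. R (R x) = x - B x"
    and comm: "\<And>S x. bounded_op S \<Longrightarrow> (\<And>x. S (B x) = B (S x)) \<Longrightarrow> S (R x) = R (S x)"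
    using sqrt_of_identity_minus_contraction[OF bB] by blast
  note bR = positive_op_bounded[OF R(1)]
  have "positive_op (\<lambda>x. sqrt k *\<^sub>R R x)"
    using R(1) k(1)
    by (intro positive_opI bounded_op_intros bR)
      (simp_all add: cinner.scaleR_left cinner.scaleR_right positive_op_self_adjoint[OF R(1)] positive_op_def)
  moreover have "sqrt k *\<^sub>R R (sqrt k *\<^sub>R R x) = A x" for x
    using k(1) by (simp add: bounded_op_scaleR[OF bR] R(2) B_def)
  moreover have "S (sqrt k *\<^sub>R R x) = sqrt k *\<^sub>R R (S x)"
    if "bounded_op S" "\<And>x. S (A x) = A (S x)" for S x
    using that comm[OF that(1)] by (simp add: bounded_op_linear B_def)
  ultimately show ?thesis
    by (intro exI[of _ "\<lambda>x. sqrt k *\<^sub>R R x"]) auto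
qed

text \<open>For \<open>y = S x - R x\<close>, commutation and equal squares give (S + R) y = 0. Both
  forms are nonnegative, so each vanishes at \<open>y\<close>; hence both operators kill
  \<open>y\<close>, and \<open>y\<close> is orthogonal to itself.\<close>

lemma positive_sqrt_unique:
  fixes A :: "'a::chilbert \<Rightarrow> 'a"
  assumes R: "positive_op R" and RR: "\<And>x. R (R x) = A x"
    and S: "positive_op S" and SS: "\<And>x. S (S x) = A x"
    and comm: "\<And>x. S (R x) = R (S x)"
  shows "S = R"
proof
  fix x
  note bR = positive_op_bounded[OF R] and bS = positive_op_bounded[OF S]
  define y where "y = S x - R x"
  have "S y + R y = 0"
    by (simp add: y_def bounded_op_diff[OF bR] bounded_op_diff[OF bS] RR SS comm)
  then have "cinner (S y) y + cinner (R y) y = 0"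
    by (metis cinner_add_left cinner.zero_left)
  moreover have "0 \<le> Re (cinner (S y) y)" "0 \<le> Re (cinner (R y) y)"
    using R S by (auto simp: positive_op_def)
  ultimately have "Re (cinner (S y) y) = 0" "Re (cinner (R y) y) = 0"
    by (auto simp: complex_eq_iff)
  then have "S y = 0" "R y = 0"
    using positive_op_eq_0 R S by blast+
  moreover have "cinner y y = cinner (S y) x - cinner (R y) x"
    by (simp add: cinner.diff_right positive_op_self_adjoint[OF R]
        positive_op_self_adjoint[OF S] flip: y_def) (simp add: y_def cinner.diff_right)
  ultimately have "cinner y y = 0"
    by (simp add: cinner.zero_left)
  then show "S x = R x"
    by (simp add: cinner_self_eq_0 y_def)
qed

lemma
  fixes A :: "'a::chilbert \<Rightarrow> 'a"
  assumes A: "positive_op A"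
  shows positive_op_sqrt: "positive_op (op_sqrt A)"
    and op_sqrt_square: "op_sqrt A (op_sqrt A x) = A x"
    and op_sqrt_commute: "bounded_op S \<Longrightarrow> (\<And>x. S (A x) = A (S x)) \<Longrightarrow> S (op_sqrt A x) = op_sqrt A (S x)"
proof -
  obtain R where R: "positive_op R" "\<And>x. R (R x) = A x"
    and comm: "\<And>S x. bounded_op S \<Longrightarrow> (\<And>x. S (A x) = A (S x)) \<Longrightarrow> S (R x) = R (S x)"
    using positive_sqrt_exists[OF A] by blast
  have "op_sqrt A = R"
    unfolding op_sqrt_def
  proof (rule the_equality)
    show "positive_op R \<and> R \<circ> R = A"
      using R by auto
    fix S assume S: "positive_op S \<and> S \<circ> S = A"
    then have SS: "S (S x) = A x" for x
      by (metis comp_apply)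
    show "S = R"
    proof (rule positive_sqrt_unique[OF R])
      \<comment> \<open>Any root \<open>S\<close> commutes with its own square \<open>A\<close>,
        hence with \<open>R\<close>, which commutes with everything that commutes with
        \<open>A\<close>.\<close>
      show "S (R x) = R (S x)" for x
        using S by (intro comm) (auto simp: positive_op_bounded SS[symmetric])
    qed (use S SS in auto)
  qed
  then show "positive_op (op_sqrt A)" "op_sqrt A (op_sqrt A x) = A x"
    "bounded_op S \<Longrightarrow> (\<And>x. S (A x) = A (S x)) \<Longrightarrow> S (op_sqrt A x) = op_sqrt A (S x)"
    using R comm by auto
qed

subsection \<open>Inverses of operators bounded below by the identity\<close>

text \<open>The lower bound gives injectivity and a complete, hence closed, range; by
  self-adjointness a vector orthogonal to the range has vanishing form and is 0.\<close>

lemma bounded_below_bij: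
  fixes A :: "'a::chilbert \<Rightarrow> 'a"
  assumes A: "bounded_op A" and sa: "\<And>x y. cinner (A x) y = cinner x (A y)"
    and below: "\<And>x. (norm x)\<^sup>2 \<le> Re (cinner (A x) x)"
  shows "bij A" and "norm x \<le> norm (A x)"
proof -
  have le: "norm x \<le> norm (A x)" for x
  proof (cases "x = 0")
    case False
    have "(norm x)\<^sup>2 \<le> norm (A x) * norm x"
      using below[of x] Cauchy_Schwarz_cinner[of "A x" x] complex_Re_le_cmod[of "cinner (A x) x"]
      by linarith
    then show ?thesis
      using False by (simp add: power2_eq_square)
  qed simp
  then show "norm x \<le> norm (A x)" .
  have inj: "inj A"
  proof (rule injI)
    fix x y assume "A x = A y"
    then show "x = y"
      using le[of "x - y"] by (simp add: bounded_op_diff[OF A])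
  qed
  have "complete (range A)"
    unfolding complete_def
  proof (intro allI impI)
    fix f assume f: "(\<forall>n. f n \<in> range A) \<and> Cauchy f"
    then have "\<forall>n. \<exists>x. f n = A x"
      by (auto simp: image_iff)
    then obtain g where g: "\<And>n. f n = A (g n)"
      by metis
    have "Cauchy g"
      unfolding Cauchy_def
    proof (intro allI impI)
      fix e :: real assume "0 < e"
      then obtain M where M: "\<And>m n. M \<le> m \<Longrightarrow> M \<le> n \<Longrightarrow> dist (f m) (f n) < e"
        using f by (meson metric_CauchyD)
      have "dist (g m) (g n) \<le> dist (f m) (f n)" for m n
        using le[of "g m - g n"] by (simp add: g dist_norm bounded_op_diff[OF A])
      then show "\<exists>M. \<forall>m\<ge>M. \<forall>n\<ge>M. dist (g m) (g n) < e"
        using M by (meson le_less_trans)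
    qed
    then obtain l where "g \<longlonglongrightarrow> l"
      using Cauchy_convergent convergent_def by blast
    then have "f \<longlonglongrightarrow> A l"
      unfolding g by (rule bounded_op_tendsto[OF A])
    then show "\<exists>l\<in>range A. f \<longlonglongrightarrow> l" by blast
  qed
  moreover have "0 \<in> range A" "A x + A y \<in> range A" "a *\<^sub>C A x \<in> range A" for a x y
    by (metis bounded_op_linear[OF A] rangeI)+
  ultimately have M: "closed_csubspace (range A)"
    unfolding closed_csubspace_def using complete_imp_closed by blast
  have "x \<in> range A" for x
  proof -
    obtain y where y: "y \<in> range A" and orth: "\<And>z. cinner (x - y) (A z) = 0"
      using orthogonal_decomposition[OF M, of x] by blast
    have "(norm (x - y))\<^sup>2 \<le> 0"
      using below[of "x - y"] orth[of "x - y"] sa[of "x - y" "x - y"] by simp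
    then show ?thesis
      using y by simp
  qed
  then show "bij A"
    using inj by (auto simp: bij_def)
qed

lemma bounded_below_inverse:
  fixes A :: "'a::chilbert \<Rightarrow> 'a"
  assumes A: "bounded_op A" and sa: "\<And>x y. cinner (A x) y = cinner x (A y)"
    and below: "\<And>x. (norm x)\<^sup>2 \<le> Re (cinner (A x) x)"
  shows "A (inv A x) = x" "inv A (A x) = x" "bounded_op (inv A)"
    "cinner (inv A x) y = cinner x (inv A y)"
    "bounded_op S \<Longrightarrow> (\<And>x. S (A x) = A (S x)) \<Longrightarrow> S (inv A x) = inv A (S x)"
proof -
  note bij = bounded_below_bij(1)[OF assms]
  show r: "A (inv A x) = x" and l: "inv A (A x) = x" for x
    using bij by (simp_all add: bij_def surj_f_inv_f)
  show "cinner (inv A x) y = cinner x (inv A y)" for x y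
    using sa[of "inv A x" "inv A y"] by (simp add: r)
  show "S (inv A x) = inv A (S x)" if "bounded_op S" "\<And>x. S (A x) = A (S x)" for S x
    using l[of "S (inv A x)"] that(2)[of "inv A x"] by (simp add: r)
  show "bounded_op (inv A)"
  proof (rule bounded_opI[of _ 1])
    show "inv A (x + y) = inv A x + inv A y" for x y
      using l[of "inv A x + inv A y"] by (simp add: bounded_op_add[OF A] r)
    show "inv A (a *\<^sub>C x) = a *\<^sub>C inv A x" for a x
      using l[of "a *\<^sub>C inv A x"] by (simp add: bounded_op_scaleC[OF A] r)
    show "norm (inv A x) \<le> 1 * norm x" for x
      using bounded_below_bij(2)[OF assms, of "inv A x"] by (simp add: r)
  qed
qed

subsection \<open>Square-summable sequences\<close>

text \<open>The Hilbert direct sum of the subspaces \<open>C i\<close>, encoded as constrained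
  sequences so that it fits the ambient type required by \<open>subnormal\<close>.\<close>

definition l2_space :: "(nat \<Rightarrow> 'a::complex_inner set) \<Rightarrow> (nat \<Rightarrow> 'a) hspace" where
  "l2_space C = \<lparr>hcarrier = {f. (\<forall>i. f i \<in> C i) \<and> summable (\<lambda>i. (norm (f i))\<^sup>2)},
     hadd = \<lambda>f g i. f i + g i, hzero = \<lambda>i. 0, hscale = \<lambda>a f i. a *\<^sub>C f i,
     hinner = \<lambda>f g. \<Sum>i. cinner (f i) (g i)\<rparr>"

lemma norm_add_square_le: "(norm (x + y))\<^sup>2 \<le> 2 * (norm x)\<^sup>2 + 2 * (norm y)\<^sup>2"
  for x y :: "'a::complex_inner"
  using norm_add_square[of x y] norm_diff_square[of x y] zero_le_power2[of "norm (x - y)"] by linarith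

lemma summable_norm_square_add:
  fixes f g :: "nat \<Rightarrow> 'a::complex_inner"
  assumes "summable (\<lambda>i. (norm (f i))\<^sup>2)" "summable (\<lambda>i. (norm (g i))\<^sup>2)"
  shows "summable (\<lambda>i. (norm (f i + g i))\<^sup>2)"
proof (rule summable_comparison_test')
  show "summable (\<lambda>i. 2 * (norm (f i))\<^sup>2 + 2 * (norm (g i))\<^sup>2)"
    using assms by (intro summable_add summable_mult)
qed (use norm_add_square_le in auto)

lemma summable_norm_square_scaleC:
  fixes f :: "nat \<Rightarrow> 'a::complex_inner"
  assumes "summable (\<lambda>i. (norm (f i))\<^sup>2)"
  shows "summable (\<lambda>i. (norm (a *\<^sub>C f i))\<^sup>2)"
  using assms by (simp add: norm_scaleC power_mult_distrib summable_mult)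

lemma summable_norm_square_diff:
  fixes f g :: "nat \<Rightarrow> 'a::complex_inner"
  assumes "summable (\<lambda>i. (norm (f i))\<^sup>2)" "summable (\<lambda>i. (norm (g i))\<^sup>2)"
  shows "summable (\<lambda>i. (norm (f i - g i))\<^sup>2)"
  using summable_norm_square_add[OF assms(1), of "\<lambda>i. - g i"] assms(2) by simp

lemma summable_cinner:
  fixes f g :: "nat \<Rightarrow> 'a::complex_inner"
  assumes "summable (\<lambda>i. (norm (f i))\<^sup>2)" "summable (\<lambda>i. (norm (g i))\<^sup>2)"
  shows "summable (\<lambda>i. cinner (f i) (g i))"
proof (rule summable_comparison_test')
  show "summable (\<lambda>i. (norm (f i))\<^sup>2 + (norm (g i))\<^sup>2)"
    using assms by (rule summable_add)
  show "cmod (cinner (f i) (g i)) \<le> (norm (f i))\<^sup>2 + (norm (g i))\<^sup>2" for i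
  proof -
    have "norm (f i) * norm (g i) \<le> (norm (f i))\<^sup>2 + (norm (g i))\<^sup>2"
      using zero_le_power2[of "norm (f i) - norm (g i)"] zero_le_power2[of "norm (f i)"]
        zero_le_power2[of "norm (g i)"] unfolding power2_diff by argo
    then show ?thesis
      using Cauchy_Schwarz_cinner order_trans by blast
  qed
qed

lemma hinner_l2_space_self:
  fixes f :: "nat \<Rightarrow> 'a::complex_inner"
  assumes "summable (\<lambda>i. (norm (f i))\<^sup>2)"
  shows "hinner (l2_space C) f f = complex_of_real (\<Sum>i. (norm (f i))\<^sup>2)"
  using suminf_of_real[OF assms, where 'a = complex] by (simp add: l2_space_def cinner_self)

lemma hnorm_l2_space:
  fixes f :: "nat \<Rightarrow> 'a::complex_inner"
  assumes "summable (\<lambda>i. (norm (f i))\<^sup>2)"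
  shows "hnorm (l2_space C) f = sqrt (\<Sum>i. (norm (f i))\<^sup>2)"
  by (simp add: hnorm_def hinner_l2_space_self[OF assms])

lemma hdist_l2_space:
  fixes f g :: "nat \<Rightarrow> 'a::complex_inner"
  assumes "summable (\<lambda>i. (norm (f i))\<^sup>2)" "summable (\<lambda>i. (norm (g i))\<^sup>2)"
  shows "hdist (l2_space C) f g = sqrt (\<Sum>i. (norm (f i - g i))\<^sup>2)"
  using hnorm_l2_space[OF summable_norm_square_diff[OF assms], of C]
  by (simp add: hdist_def l2_space_def scaleC_minus_one)

text \<open>The limit is taken coordinatewise. The Cauchy bound holds for all finite partial sums,
  survives the limit in the second index there, and only then is the number of terms sent to
  infinity.\<close>

lemma l2_space_complete:
  fixes C :: "nat \<Rightarrow> 'a::chilbert set" and f :: "nat \<Rightarrow> nat \<Rightarrow> 'a"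
  assumes C: "\<And>i. closed_csubspace (C i)"
    and f: "\<And>n. f n \<in> hcarrier (l2_space C)"
    and C_seq: "\<forall>e>0. \<exists>N. \<forall>m\<ge>N. \<forall>n\<ge>N. hdist (l2_space C) (f m) (f n) < e"
  shows "\<exists>l\<in>hcarrier (l2_space C). \<forall>e>0. \<exists>N. \<forall>n\<ge>N. hdist (l2_space C) (f n) l < e"
proof -
  have fC: "f n i \<in> C i" and fs: "summable (\<lambda>i. (norm (f n i))\<^sup>2)" for n i
    using f by (simp_all add: l2_space_def)
  note ds = summable_norm_square_diff[OF fs fs]
  have partial_le: "(\<Sum>i<k. (norm (f m i - f n i))\<^sup>2) \<le> e\<^sup>2"
    if "hdist (l2_space C) (f m) (f n) < e" for k m n e
  proof -
    have "(\<Sum>i. (norm (f m i - f n i))\<^sup>2) = (hdist (l2_space C) (f m) (f n))\<^sup>2"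
      by (simp add: hdist_l2_space[OF fs fs] suminf_nonneg[OF ds])
    also have "\<dots> \<le> e\<^sup>2"
      using that by (intro power_mono) (auto simp: hdist_l2_space[OF fs fs] suminf_nonneg[OF ds])
    finally show ?thesis
      using sum_le_suminf[OF ds, of "{..<k}" m n] by simp
  qed
  have "Cauchy (\<lambda>n. f n i)" for i
  proof (rule metric_CauchyI)
    fix e :: real assume e: "0 < e"
    then obtain N where N: "\<And>m n. N \<le> m \<Longrightarrow> N \<le> n \<Longrightarrow> hdist (l2_space C) (f m) (f n) < e/2"
      using C_seq[rule_format, of "e/2"] by auto
    show "\<exists>M. \<forall>m\<ge>M. \<forall>n\<ge>M. dist (f m i) (f n i) < e"
    proof (intro exI allI impI)
      fix m n assume "N \<le> m" "N \<le> n"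
      have "(norm (f m i - f n i))\<^sup>2 \<le> (\<Sum>i<Suc i. (norm (f m i - f n i))\<^sup>2)"
        by (simp add: sum_nonneg)
      also have "\<dots> \<le> (e/2)\<^sup>2"
        using partial_le N \<open>N \<le> m\<close> \<open>N \<le> n\<close> by blast
      finally have "norm (f m i - f n i) \<le> e/2"
        using e by (simp add: power2_le_iff_abs_le del: power_divide)
      then show "dist (f m i) (f n i) < e"
        using e by (simp add: dist_norm)
    qed
  qed
  then have "\<exists>l. (\<lambda>n. f n i) \<longlonglongrightarrow> l" for i
    using Cauchy_convergent convergent_def by blast
  then obtain l where l: "\<And>i. (\<lambda>n. f n i) \<longlonglongrightarrow> l i"
    by metis
  have lC: "l i \<in> C i" for i
    using C[of i] fC l[of i] closed_sequentially[of "C i" "\<lambda>n. f n i"] by (simp add: closed_csubspace_def)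
  have tail: "summable (\<lambda>i. (norm (f m i - l i))\<^sup>2) \<and> (\<Sum>i. (norm (f m i - l i))\<^sup>2) \<le> e\<^sup>2"
    if N: "\<And>n. N \<le> n \<Longrightarrow> hdist (l2_space C) (f m) (f n) < e" for m N e
  proof -
    have le: "(\<Sum>i<k. (norm (f m i - l i))\<^sup>2) \<le> e\<^sup>2" for k
    proof (rule tendsto_upperbound)
      show "(\<lambda>n. \<Sum>i<k. (norm (f m i - f n i))\<^sup>2) \<longlonglongrightarrow> (\<Sum>i<k. (norm (f m i - l i))\<^sup>2)"
        by (intro tendsto_intros l)
      show "\<forall>\<^sub>F n in sequentially. (\<Sum>i<k. (norm (f m i - f n i))\<^sup>2) \<le> e\<^sup>2"
        using partial_le N eventually_sequentially by blast
    qed simp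
    then have "summable (\<lambda>i. (norm (f m i - l i))\<^sup>2)"
      by (intro summableI_nonneg_bounded[where x = "e\<^sup>2"]) auto
    then show ?thesis
      using suminf_le_const le by blast
  qed
  obtain N1 where "\<And>m n. N1 \<le> m \<Longrightarrow> N1 \<le> n \<Longrightarrow> hdist (l2_space C) (f m) (f n) < 1"
    using C_seq[rule_format, of 1] by auto
  then have "summable (\<lambda>i. (norm (f N1 i - l i))\<^sup>2)"
    using tail[of N1 N1 1] by simp
  \<comment> \<open>\<open>l\<close> is the difference of the square-summable sequences
    \<open>f N1\<close> and \<open>f N1 - l\<close>.\<close>
  from summable_norm_square_diff[OF fs[of N1] this] have ls: "summable (\<lambda>i. (norm (l i))\<^sup>2)"
    by simp
  show ?thesis
  proof (intro bexI allI impI)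
    show "l \<in> hcarrier (l2_space C)"
      using lC ls by (simp add: l2_space_def)
    fix e :: real assume e: "0 < e"
    then obtain N where N: "\<And>m n. N \<le> m \<Longrightarrow> N \<le> n \<Longrightarrow> hdist (l2_space C) (f m) (f n) < e/2"
      using C_seq[rule_format, of "e/2"] by auto
    show "\<exists>N. \<forall>n\<ge>N. hdist (l2_space C) (f n) l < e"
    proof (intro exI allI impI)
      fix n assume "N \<le> n"
      then have "(\<Sum>i. (norm (f n i - l i))\<^sup>2) \<le> (e/2)\<^sup>2"
        using tail[of N n "e/2"] N by blast
      then have "hdist (l2_space C) (f n) l \<le> sqrt ((e/2)\<^sup>2)"
        unfolding hdist_l2_space[OF fs ls] by (rule real_sqrt_le_mono)
      then show "hdist (l2_space C) (f n) l < e"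
        using e by simp
    qed
  qed
qed

lemma is_hilbert_space_l2_space:
  fixes C :: "nat \<Rightarrow> 'a::chilbert set"
  assumes C: "\<And>i. closed_csubspace (C i)"
  shows "is_hilbert_space (l2_space C)"
proof -
  let ?K = "l2_space C"
  have sub: "0 \<in> C i" "x \<in> C i \<Longrightarrow> y \<in> C i \<Longrightarrow> x + y \<in> C i" "x \<in> C i \<Longrightarrow> a *\<^sub>C x \<in> C i" for x y a i
    using C[of i] by (auto simp: closed_csubspace_def)
  have neg: "\<exists>y\<in>hcarrier ?K. hadd ?K x y = hzero ?K" if "x \<in> hcarrier ?K" for x
  proof
    show "(\<lambda>i. - x i) \<in> hcarrier ?K"
      using that sub(3)[of _ _ "-1"] by (simp add: l2_space_def scaleC_minus_one)
  qed (simp add: l2_space_def)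
  have definite: "x = hzero ?K" if x: "x \<in> hcarrier ?K" "hinner ?K x x = 0" for x
  proof -
    have s: "summable (\<lambda>i. (norm (x i))\<^sup>2)"
      using x(1) by (simp add: l2_space_def)
    then have "(\<Sum>i. (norm (x i))\<^sup>2) = 0"
      using x(2) by (simp add: hinner_l2_space_self)
    then show ?thesis
      by (simp add: suminf_eq_zero_iff[OF s] l2_space_def fun_eq_iff)
  qed
  have self: "Im (hinner ?K x x) = 0 \<and> 0 \<le> Re (hinner ?K x x)" if "x \<in> hcarrier ?K" for x
    using that by (subst (1 2) hinner_l2_space_self) (simp_all add: l2_space_def suminf_nonneg)
  have commute: "hinner ?K x y = cnj (hinner ?K y x)" if "x \<in> hcarrier ?K" "y \<in> hcarrier ?K" for x y
  proof -
    have "summable (\<lambda>i. cinner (y i) (x i))"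
      using that by (intro summable_cinner) (simp_all add: l2_space_def)
    from bounded_linear.suminf[OF bounded_linear_cnj this] show ?thesis
      by (simp add: l2_space_def flip: cinner_commute)
  qed
  show ?thesis
    unfolding is_hilbert_space_def Let_def
  proof (intro conjI)
    show "\<forall>f::nat \<Rightarrow> nat \<Rightarrow> 'a. (\<forall>n. f n \<in> hcarrier ?K) \<longrightarrow>
        (\<forall>e>0. \<exists>N. \<forall>m\<ge>N. \<forall>n\<ge>N. hdist ?K (f m) (f n) < e) \<longrightarrow>
        (\<exists>l\<in>hcarrier ?K. \<forall>e>0. \<exists>N. \<forall>n\<ge>N. hdist ?K (f n) l < e)"
    proof (intro allI impI)
      fix f :: "nat \<Rightarrow> nat \<Rightarrow> 'a"
      assume "\<forall>n. f n \<in> hcarrier ?K"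
      then have "f n \<in> hcarrier ?K" for n ..
      moreover assume "\<forall>e>0. \<exists>N. \<forall>m\<ge>N. \<forall>n\<ge>N. hdist ?K (f m) (f n) < e"
      ultimately show "\<exists>l\<in>hcarrier ?K. \<forall>e>0. \<exists>N. \<forall>n\<ge>N. hdist ?K (f n) l < e"
        by (rule l2_space_complete[OF C])
    qed
    show "\<forall>x\<in>hcarrier ?K. \<exists>y\<in>hcarrier ?K. hadd ?K x y = hzero ?K"
      using neg by blast
    show "\<forall>x\<in>hcarrier ?K. hinner ?K x x = 0 \<longrightarrow> x = hzero ?K"
      using definite by blast
    show "\<forall>x\<in>hcarrier ?K. Im (hinner ?K x x) = 0 \<and> 0 \<le> Re (hinner ?K x x)"
      using self by blast
    show "\<forall>x\<in>hcarrier ?K. \<forall>y\<in>hcarrier ?K. hinner ?K x y = cnj (hinner ?K y x)"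
      using commute by blast
    show "\<forall>x\<in>hcarrier ?K. \<forall>y\<in>hcarrier ?K. \<forall>w\<in>hcarrier ?K.
        hinner ?K (hadd ?K x y) w = hinner ?K x w + hinner ?K y w"
      by (auto simp: l2_space_def cinner_add_left summable_cinner suminf_add)
    show "\<forall>a. \<forall>x\<in>hcarrier ?K. \<forall>y\<in>hcarrier ?K. hinner ?K (hscale ?K a x) y = a * hinner ?K x y"
      by (auto simp: l2_space_def cinner_scaleC_left summable_cinner suminf_mult)
  qed (simp_all add: l2_space_def sub summable_norm_square_add summable_norm_square_scaleC add_ac
      scaleC_add_right scaleC_add_left scaleC_scaleC scaleC_one)
qed

subsection \<open>Normal extensions of quasinormal operators\<close>

text \<open>For an isometry \<open>W\<close> commuting with a self-adjoint \<open>B\<close>, the operator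
  \<open>(x\<^sub>0, x\<^sub>1, x\<^sub>2, \<dots>) \<mapsto> (W B x\<^sub>0 + B x\<^sub>1, B x\<^sub>2, B x\<^sub>3, \<dots>)\<close> on
  the square-summable sequences with \<open>x\<^sub>i \<in> ker W\<^sup>*\<close> for \<open>i \<ge> 1\<close> is normal and extends \<open>W B\<close>. Two such
  extensions, indexed by the parity of the position, are interleaved in one sequence, which
  explains the shifts by two.\<close>

lemma subnormal_if_in_quasinormal_sum:
  fixes T :: "'a::chilbert \<Rightarrow> 'a" and W B R :: "bool \<Rightarrow> 'a \<Rightarrow> 'a"
  assumes T: "bounded_op T"
    and W: "\<And>j. bounded_op (W j)" "\<And>j x y. cinner (W j x) (W j y) = cinner x y"
    and B: "\<And>j. bounded_op (B j)" "\<And>j x y. cinner (B j x) y = cinner x (B j y)"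
    and WB: "\<And>j x. W j (B j x) = B j (W j x)"
    and R: "\<And>j. bounded_op (R j)" "\<And>j x. W j (B j (R j x)) = R j (T x)"
      "\<And>x y. cinner (R True x) (R True y) + cinner (R False x) (R False y) = cinner x y"
  shows "subnormal T"
proof -
  define V where "V i = W (even i)" for i :: nat
  define Q where "Q i = B (even i)" for i :: nat
  have V_shift [simp]: "V (Suc (Suc i)) = V i" and Q_shift [simp]: "Q (Suc (Suc i)) = Q i" for i
    by (simp_all add: V_def Q_def)
  have V: "bounded_op (V i)" and V_iso: "cinner (V i x) (V i y) = cinner x y" for i x y
    using W by (simp_all add: V_def)
  have Q: "bounded_op (Q i)" and Q_sa: "cinner (Q i x) y = cinner x (Q i y)" for i x y
    using B by (simp_all add: Q_def)
  have VQ: "V i (Q i x) = Q i (V i x)" for i x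
    using WB by (simp add: V_def Q_def)
  define V' where "V' i = cadj (V i)" for i
  have V': "bounded_op (V' i)" for i
    unfolding V'_def by (rule bounded_op_cadj[OF V])
  have V'_shift [simp]: "V' (Suc (Suc i)) = V' i" for i
    by (simp add: V'_def)
  have adj: "cinner (V i x) y = cinner x (V' i y)" for i x y
    unfolding V'_def by (rule cinner_cadj[OF V])
  have V'V: "V' i (V i x) = x" for i x
    by (rule cinner_ext_right) (simp add: V_iso flip: adj)
  have V'Q: "V' i (Q i x) = Q i (V' i x)" for i x
    by (rule cinner_ext_right) (simp add: VQ flip: adj Q_sa)
  have normV: "norm (V i x) = norm x" for i x
    using V_iso[of i x x] by (simp add: norm_eq_sqrt_cinner)
  note lin = bounded_op_linear[OF V] bounded_op_linear[OF Q] bounded_op_linear[OF V']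

  obtain c where c: "\<And>i x. norm (Q i x) \<le> c * norm x"
  proof -
    obtain c1 where c1: "0 < c1" "\<And>x. norm (B True x) \<le> c1 * norm x"
      using bounded_op_bound[OF B(1)] by blast
    obtain c2 where c2: "0 < c2" "\<And>x. norm (B False x) \<le> c2 * norm x"
      using bounded_op_bound[OF B(1)] by blast
    have "norm (B j x) \<le> (c1 + c2) * norm x" for j x
      using c1(2)[of x] c2(2)[of x] c1(1) c2(1)
      by (cases j) (simp_all add: distrib_right add_increasing add_increasing2)
    then have "norm (Q i x) \<le> (c1 + c2) * norm x" for i x
      by (simp add: Q_def)
    then show thesis
      by (rule that)
  qed
  have Q_le: "(norm (Q i x))\<^sup>2 \<le> c\<^sup>2 * (norm x)\<^sup>2" for i x
    using power_mono[OF c norm_ge_zero, of i x 2] by (simp add: power_mult_distrib)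

  define C where "C i = (if i < 2 then UNIV else {x. V' i x = 0})" for i
  have C: "closed_csubspace (C i)" for i
  proof -
    have "closed {x. V' i x = 0}"
      using closed_Collect_eq[OF linear_continuous_on[OF bounded_op_bounded_linear[OF V']] continuous_on_const] .
    then show ?thesis
      by (auto simp: closed_csubspace_def C_def lin scaleC_zero_right)
  qed
  define K where "K = l2_space C"
  \<comment> \<open>Entries in the kernel of \<open>V'\<close> are orthogonal to the range of
    \<open>V\<close>, so the two summands at positions 0 and 1 do not interact; this is what makes
    \<open>N\<close> normal.\<close>
  define N where "N f i = (if i < 2 then V i (Q i (f i)) else 0) + Q i (f (i + 2))" for f and i :: nat
  \<comment> \<open>The adjoint of \<open>N\<close>. Positions 2 and 3 receive the unconstrained
    entries 0 and 1, so I - V V' has to project these to the kernel; later entries already lie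
    there.\<close>
  define M where "M f i = (if i < 2 then V' i (Q i (f i))
      else if i < 4 then Q i (f (i - 2)) - V i (V' i (Q i (f (i - 2)))) else Q i (f (i - 2)))" for f and i :: nat
  define J where "J x i = (if i < 2 then R (even i) x else 0)" for x and i :: nat

  have mem: "f \<in> hcarrier K \<longleftrightarrow> (\<forall>i\<ge>2. V' i (f i) = 0) \<and> summable (\<lambda>i. (norm (f i))\<^sup>2)" for f
    by (auto simp: K_def l2_space_def C_def)
  have ker: "V' i (f (Suc (Suc i))) = 0" if "f \<in> hcarrier K" for f i
    using that[unfolded mem, THEN conjunct1, rule_format, of "Suc (Suc i)"] by simp
  have add: "hadd K f g = (\<lambda>i. f i + g i)" and scale: "hscale K a f = (\<lambda>i. a *\<^sub>C f i)"
    and inner: "hinner K f g = (\<Sum>i. cinner (f i) (g i))" for f g a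
    by (simp_all add: K_def l2_space_def)

  have N_le: "(norm (N f i))\<^sup>2 \<le> 2 * c\<^sup>2 * (norm (f i))\<^sup>2 + 2 * c\<^sup>2 * (norm (f (i + 2)))\<^sup>2" for f i
  proof -
    let ?a = "if i < 2 then V i (Q i (f i)) else 0"
    have "(norm ?a)\<^sup>2 \<le> c\<^sup>2 * (norm (f i))\<^sup>2"
      using Q_le[of i "f i"] by (simp add: normV)
    then show ?thesis
      using norm_add_square_le[of ?a "Q i (f (i + 2))"] Q_le[of i "f (i + 2)"]
      unfolding N_def by linarith
  qed
  have shift: "summable (\<lambda>i. (norm (f (i + 2)))\<^sup>2)" if "summable (\<lambda>i. (norm (f i))\<^sup>2)" for f :: "nat \<Rightarrow> 'a"
    using that by (rule summable_ignore_initial_segment)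
  have bound_summable: "summable (\<lambda>i. 2 * c\<^sup>2 * (norm (f i))\<^sup>2 + 2 * c\<^sup>2 * (norm (f (i + 2)))\<^sup>2)"
    if "summable (\<lambda>i. (norm (f i))\<^sup>2)" for f :: "nat \<Rightarrow> 'a"
    using that shift[OF that] by (intro summable_add summable_mult)
  have N_summable: "summable (\<lambda>i. (norm (N f i))\<^sup>2)" if "summable (\<lambda>i. (norm (f i))\<^sup>2)" for f
    using bound_summable[OF that] by (rule summable_comparison_test') (use N_le in auto)
  have N_mem: "N f \<in> hcarrier K" if "f \<in> hcarrier K" for f
    using that N_summable ker[OF that] by (simp add: mem N_def V'Q lin)
  have N_norm: "hnorm K (N f) \<le> (2 * \<bar>c\<bar>) * hnorm K f" if "f \<in> hcarrier K" for f
  proof -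
    have s: "summable (\<lambda>i. (norm (f i))\<^sup>2)"
      using that by (simp add: mem)
    have "(\<Sum>i. (norm (N f i))\<^sup>2) \<le> (\<Sum>i. 2 * c\<^sup>2 * (norm (f i))\<^sup>2 + 2 * c\<^sup>2 * (norm (f (i + 2)))\<^sup>2)"
      by (rule suminf_le[OF N_le N_summable[OF s] bound_summable[OF s]])
    also have "\<dots> = 2 * c\<^sup>2 * (\<Sum>i. (norm (f i))\<^sup>2) + 2 * c\<^sup>2 * (\<Sum>i. (norm (f (i + 2)))\<^sup>2)"
      using s shift[OF s] by (simp add: suminf_add[symmetric] suminf_mult summable_mult)
    also have "\<dots> \<le> 2 * c\<^sup>2 * (\<Sum>i. (norm (f i))\<^sup>2) + 2 * c\<^sup>2 * (\<Sum>i. (norm (f i))\<^sup>2)"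
      using suminf_split_initial_segment[OF s, of 2] by (intro add_left_mono mult_left_mono) (simp_all add: sum_nonneg)
    also have "\<dots> = (2 * \<bar>c\<bar>)\<^sup>2 * (\<Sum>i. (norm (f i))\<^sup>2)"
      by (simp add: power_mult_distrib)
    finally have "(\<Sum>i. (norm (N f i))\<^sup>2) \<le> (2 * \<bar>c\<bar>)\<^sup>2 * (\<Sum>i. (norm (f i))\<^sup>2)" .
    then have "sqrt (\<Sum>i. (norm (N f i))\<^sup>2) \<le> sqrt ((2 * \<bar>c\<bar>)\<^sup>2 * (\<Sum>i. (norm (f i))\<^sup>2))"
      by (rule real_sqrt_le_mono)
    then show ?thesis
      unfolding K_def hnorm_l2_space[OF s] hnorm_l2_space[OF N_summable[OF s]]
      by (simp only: real_sqrt_mult real_sqrt_abs)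
  qed
  have N_bounded: "hbounded_op K N"
    unfolding hbounded_op_def using N_mem N_norm
    by (auto simp: add scale N_def lin scaleC_add_right scaleC_zero_right fun_eq_iff)

  have M_summable: "summable (\<lambda>i. (norm (M f i))\<^sup>2)" if "summable (\<lambda>i. (norm (f i))\<^sup>2)" for f
  proof -
    \<comment> \<open>From position 4 on, \<open>M\<close> is a shift followed by \<open>Q\<close>;
      the finitely many other terms do not matter.\<close>
    have "summable (\<lambda>i. (norm (M f (i + 4)))\<^sup>2)"
    proof (rule summable_comparison_test')
      show "summable (\<lambda>i. c\<^sup>2 * (norm (f (i + 2)))\<^sup>2)"
        using shift[OF that] by (rule summable_mult)
      show "norm ((norm (M f (i + 4)))\<^sup>2) \<le> c\<^sup>2 * (norm (f (i + 2)))\<^sup>2" for i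
        using Q_le[of "i + 4" "f (i + 2)"] by (simp add: M_def)
    qed
    then show ?thesis
      by (subst (asm) summable_iff_shift)
  qed
  have M_mem: "M f \<in> hcarrier K" if "f \<in> hcarrier K" for f
  proof -
    have "V' i (M f i) = 0" if i: "2 \<le> i" for i
    proof (cases "i < 4")
      case True
      then show ?thesis
        using i by (simp add: M_def lin V'V)
    next
      case False
      define k where "k = i - 4"
      have "i = k + 4"
        using False by (simp add: k_def)
      then show ?thesis
        using \<open>f \<in> hcarrier K\<close>[unfolded mem, THEN conjunct1, rule_format, of "k + 2"]
        by (simp add: M_def V'Q lin numeral_eq_Suc)
    qed
    then show ?thesis
      using that M_summable by (simp add: mem)
  qed
  have MN_adj: "hinner K (N f) g = hinner K f (M g)" if f: "f \<in> hcarrier K" and g: "g \<in> hcarrier K" for f g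
  proof -
    have fs: "summable (\<lambda>i. (norm (f i))\<^sup>2)" and gs: "summable (\<lambda>i. (norm (g i))\<^sup>2)"
      using f g by (simp_all add: mem)
    define a where "a i = (if i < 2 then cinner (V i (Q i (f i))) (g i) else 0)" for i
    have 1: "cinner (N f i) (g i) = a i + cinner (f (i + 2)) (M g (i + 2))" for i
    proof -
      \<comment> \<open>The correction term in \<open>M\<close> is invisible to the pairing, because
        \<open>V'\<close> kills the tail entry \<open>f (i + 2)\<close>.\<close>
      have "cinner (V i (V' i (Q i (g i)))) (f (i + 2)) = 0"
        using ker[OF f, of i] by (metis adj cinner_commute cinner.zero_left complex_cnj_zero add_2_eq_Suc')
      then have "cinner (f (i + 2)) (V i (V' i (Q i (g i)))) = 0"
        by (metis cinner_commute complex_cnj_zero)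
      then show ?thesis
        by (simp add: N_def M_def a_def cinner_add_left cinner.diff_right cinner.zero_left Q_sa)
    qed
    have 2: "cinner (f i) (M g i) = a i" if "i < 2" for i
      using that by (simp add: a_def M_def VQ Q_sa adj V'Q)
    have a: "a sums (\<Sum>i<2. a i)"
      using sums_finite[of "{..<2}" a] by (simp add: a_def)
    have s: "summable (\<lambda>i. cinner (f i) (M g i))"
      by (rule summable_cinner[OF fs M_summable[OF gs]])
    have s2: "summable (\<lambda>i. cinner (f (i + 2)) (M g (i + 2)))"
      using s by (rule summable_ignore_initial_segment)
    have "hinner K (N f) g = (\<Sum>i<2. a i) + (\<Sum>i. cinner (f (i + 2)) (M g (i + 2)))"
      unfolding inner 1 using suminf_add[OF sums_summable[OF a] s2] sums_unique[OF a] by simp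
    also have "\<dots> = hinner K f (M g)"
      unfolding inner using suminf_split_initial_segment[OF s, of 2] by (simp add: 2)
    finally show ?thesis .
  qed
  \<comment> \<open>Both products act as the square of \<open>Q\<close> in every position. For
    \<open>N M\<close> at positions 0 and 1, the parts V V' and I - V V' add up to the
    identity.\<close>
  have NM: "N (M f) i = Q i (Q i (f i))" for f i
    by (auto simp: N_def M_def lin VQ V'Q)
  have MN: "M (N f) i = Q i (Q i (f i))" if f: "f \<in> hcarrier K" for f i
  proof -
    show ?thesis
    proof (cases "i < 2")
      case True
      then show ?thesis
        using ker[OF f, of i] by (simp add: M_def N_def lin V'Q V'V VQ[symmetric])
    next
      case False
      define k where "k = i - 2"
      have i: "i = Suc (Suc k)"
        using False by (simp add: k_def)
      show ?thesis
        using ker[OF f, of i] ker[OF f, of k] by (auto simp: M_def N_def lin V'Q V'V VQ[symmetric] i)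
    qed
  qed
  have normal: "hnormal_op K N"
    unfolding hnormal_op_def using N_bounded M_mem MN_adj by (intro conjI exI[of _ M]) (auto simp: NM MN)

  have "J x \<in> hcarrier K" for x
  proof -
    have "summable (\<lambda>i. (norm (J x i))\<^sup>2)"
      by (rule summable_finite[of "{..<2}"]) (auto simp: J_def)
    then show ?thesis
      by (auto simp: mem J_def lin)
  qed
  moreover have "J (x + y) = hadd K (J x) (J y)" and "J (a *\<^sub>C x) = hscale K a (J x)" for x y a
    by (auto simp: J_def add scale bounded_op_linear[OF R(1)] scaleC_zero_right)
  moreover have "hinner K (J x) (J y) = cinner x y" for x y
  proof -
    have "hinner K (J x) (J y) = (\<Sum>i<2. cinner (J x i) (J y i))"
      unfolding inner by (rule suminf_finite) (auto simp: J_def cinner.zero_left)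
    then show ?thesis
      using R(3)[of x y] by (simp add: J_def numeral_2_eq_2)
  qed
  moreover have "N (J x) = J (T x)" for x
    by (auto simp: N_def J_def lin V_def Q_def R(2) fun_eq_iff bounded_op_linear[OF B(1)])
  moreover have "is_hilbert_space K"
    unfolding K_def by (rule is_hilbert_space_l2_space[OF C])
  ultimately show ?thesis
    unfolding subnormal_def using T normal by blast
qed

subsection \<open>The structure of a quasi-Brownian isometry\<close>

text \<open>Symmetry of the chosen map is derived first; linearity then follows by moving
  \<open>E\<close> to the other side of the inner product.\<close>

lemma orthogonal_projection_exists:
  fixes M :: "'a::chilbert set"
  assumes M: "closed_csubspace M"
  shows "\<exists>E. bounded_op E \<and> (\<forall>x y. cinner (E x) y = cinner x (E y)) \<and> (\<forall>x. E x \<in> M) \<and> (\<forall>x\<in>M. E x = x)"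
proof -
  obtain E where E: "\<And>x. E x \<in> M" and orth: "\<And>x z. z \<in> M \<Longrightarrow> cinner (x - E x) z = 0"
    using orthogonal_decomposition[OF M] by metis
  have left: "cinner x z = cinner (E x) z" if "z \<in> M" for x z
    using orth[OF that, of x] by (simp add: cinner.diff_left)
  have sa: "cinner (E x) y = cinner x (E y)" for x y
    using left[OF E, of y x] left[OF E, of x y] by (metis cinner_commute)
  have "norm (E x) \<le> 1 * norm x" for x
  proof -
    have "(norm (E x))\<^sup>2 = cmod (cinner x (E x))"
      by (simp add: left[OF E] cinner_self norm_power)
    also have "\<dots> \<le> norm x * norm (E x)"
      by (rule Cauchy_Schwarz_cinner)
    finally show ?thesis
      by (cases "norm (E x) = 0") (simp_all add: power2_eq_square)
  qed
  then have "bounded_op E"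
    by (intro bounded_opI[of _ 1] cinner_ext)
      (simp_all add: sa cinner_add_left cinner_scaleC_left)
  moreover have "E x = x" if "x \<in> M" for x
    using orth[OF closed_csubspace_diff[OF M that E], of x x] by (simp add: cinner_self_eq_0)
  ultimately show ?thesis
    using E sa by blast
qed

locale quasi_brownian_isometry =
  fixes T :: "'a::chilbert \<Rightarrow> 'a"
  assumes quasi_brownian: "quasi_brownian T"
begin

section \<open>The modulus squared \<open>A\<close>, positivity of the defect and its root
  \<open>D\<close>\<close>

definition A :: "'a \<Rightarrow> 'a" where "A = cadj T \<circ> T"
definition D :: "'a \<Rightarrow> 'a" where "D = op_sqrt (Delta T)"

lemma bounded_T: "bounded_op T"
  using quasi_brownian by (simp add: quasi_brownian_def two_isometry_def)

lemma A_apply: "A x = cadj T (T x)"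
  by (simp add: A_def)

lemma bounded_A: "bounded_op A"
  using bounded_op_compose[OF bounded_op_cadj[OF bounded_T] bounded_T] by (simp add: A_def comp_def)

lemma cinner_A: "cinner (A x) y = cinner (T x) (T y)"
  by (simp add: A_apply cinner_cadj'[OF bounded_T])

lemma cinner_A_right: "cinner x (A y) = cinner (T x) (T y)"
  by (simp add: A_apply cinner_cadj[OF bounded_T])

lemma cadj_A_T: "cadj T (A (T x)) = 2 *\<^sub>R A x - x"
proof -
  have "x - 2 *\<^sub>R A x + cadj T (A (T x)) = 0"
    using quasi_brownian scaleR_scaleC[of 2 "A x"]
    by (simp add: quasi_brownian_def two_isometry_def A_apply)
  then show ?thesis
    by (simp add: algebra_simps add_eq_0_iff)
qed

lemma norm_T_T: "(norm (T (T x)))\<^sup>2 = 2 * (norm (T x))\<^sup>2 - (norm x)\<^sup>2"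
proof -
  have "cinner (T (T x)) (T (T x)) = cinner (cadj T (A (T x))) x"
    by (simp add: cinner_cadj'[OF bounded_T] cinner_A)
  then have "cinner (T (T x)) (T (T x)) = 2 * cinner (T x) (T x) - cinner x x"
    by (simp add: cadj_A_T cinner.diff_left cinner.scaleR_left cinner_A scaleR_conv_of_real)
  then have "complex_of_real ((norm (T (T x)))\<^sup>2) = complex_of_real (2 * (norm (T x))\<^sup>2 - (norm x)\<^sup>2)"
    by (simp add: cinner_self)
  then show ?thesis
    by (simp only: of_real_eq_iff)
qed

text \<open>Along the orbit of \<open>x\<close> the squared norm is affine in the exponent; a
  negative slope would make it negative eventually.\<close>

lemma norm_T_ge: "norm x \<le> norm (T x)"
proof (rule ccontr)
  define d where "d = (norm x)\<^sup>2 - (norm (T x))\<^sup>2"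
  assume "\<not> norm x \<le> norm (T x)"
  then have d: "0 < d"
    by (simp add: d_def power_strict_mono)
  have lin: "(norm ((T ^^ n) x))\<^sup>2 = (norm x)\<^sup>2 - real n * d \<and>
      (norm ((T ^^ Suc n) x))\<^sup>2 = (norm x)\<^sup>2 - real (Suc n) * d" for n
    by (induction n) (auto simp: d_def norm_T_T algebra_simps)
  obtain n :: nat where "(norm x)\<^sup>2 < real n * d"
    using reals_Archimedean3[OF d] by blast
  then show False
    using lin[of n] zero_le_power2[of "norm ((T ^^ n) x)"] by linarith
qed

lemma Delta_apply: "Delta T x = A x - x"
  by (simp add: Delta_def A_apply)

lemma positive_Delta: "positive_op (Delta T)"
proof (rule positive_opI)
  have "Delta T = (\<lambda>x. A x - x)"
    by (simp add: fun_eq_iff Delta_apply)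
  then show "bounded_op (Delta T)"
    by (simp add: bounded_op_minus bounded_A bounded_op_ident)
  show "0 \<le> Re (cinner (Delta T x) x)" for x
    using power_mono[OF norm_T_ge norm_ge_zero, of x 2]
    by (simp add: Delta_apply cinner.diff_left cinner_A cinner_self)
qed (simp add: Delta_apply cinner.diff_left cinner.diff_right cinner_A cinner_A_right)

lemma bounded_D: "bounded_op D"
  and D_self_adjoint: "cinner (D x) y = cinner x (D y)"
  unfolding D_def using positive_op_sqrt[OF positive_Delta]
  by (auto intro: positive_op_bounded positive_op_self_adjoint)

lemma D_D: "D (D x) = A x - x"
  unfolding D_def by (simp add: op_sqrt_square[OF positive_Delta] Delta_apply)

lemma A_eq: "A x = x + D (D x)"
  by (simp add: D_D)

lemma D_D_T: "D (D (T x)) = D (T (D x))"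
proof -
  have "(Delta T \<circ> T) x = (D \<circ> T \<circ> D) x"
    using quasi_brownian by (simp add: quasi_brownian_def D_def)
  then show ?thesis
    by (simp add: D_D Delta_apply)
qed

text \<open>This is the 2-isometry identity in the form that \<open>T\<close> preserves the seminorm
  of \<open>D\<close>.\<close>

lemma cinner_D_T: "cinner (D (T x)) (D (T y)) = cinner (D x) (D y)"
proof -
  have "cinner (D (T x)) (D (T y)) = cinner (D (D (T x))) (T y)"
    by (simp add: D_self_adjoint)
  also have "\<dots> = cinner (cadj T (A (T x)) - A x) y"
    by (simp add: D_D cinner.diff_left cinner_cadj'[OF bounded_T] cinner_A)
  also have "\<dots> = cinner (D (D x)) y"
    by (simp add: cadj_A_T D_D scaleR_2)
  finally show ?thesis
    by (simp add: D_self_adjoint)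
qed

lemma D_eq_0: "D x = 0" if "D (D x) = 0"
proof -
  have "cinner (D x) (D x) = 0"
    using that D_self_adjoint[of "D x" x] by (simp add: cinner.zero_left)
  then show ?thesis
    by (simp add: cinner_self_eq_0)
qed

text \<open>\<open>E\<close> projects onto \<open>ker \<Delta>\<close>, which \<open>T\<close> leaves invariant; \<open>X\<close> is the compression of \<open>T\<close> to the
  complement, an isometry there that commutes with \<open>\<Delta>\<close>.\<close>

definition E :: "'a \<Rightarrow> 'a" where
  "E = (SOME E. bounded_op E \<and> (\<forall>x y. cinner (E x) y = cinner x (E y))
     \<and> (\<forall>x. D (E x) = 0) \<and> (\<forall>x. D x = 0 \<longrightarrow> E x = x))"
definition F :: "'a \<Rightarrow> 'a" where "F x = x - E x"
definition X :: "'a \<Rightarrow> 'a" where "X x = F (T x)"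

lemma bounded_E: "bounded_op E"
  and E_self_adjoint: "cinner (E x) y = cinner x (E y)"
  and D_E: "D (E x) = 0"
  and E_fixed: "D x = 0 \<Longrightarrow> E x = x"
proof -
  have "closed {x. D x = 0}"
    using closed_Collect_eq[OF linear_continuous_on[OF bounded_op_bounded_linear[OF bounded_D]] continuous_on_const] .
  then have "closed_csubspace {x. D x = 0}"
    by (auto simp: closed_csubspace_def bounded_op_linear[OF bounded_D] scaleC_zero_right)
  from orthogonal_projection_exists[OF this]
  have "\<exists>E. bounded_op E \<and> (\<forall>x y. cinner (E x) y = cinner x (E y))
     \<and> (\<forall>x. D (E x) = 0) \<and> (\<forall>x. D x = 0 \<longrightarrow> E x = x)"
    by (simp only: mem_Collect_eq Ball_def)
  from someI_ex[OF this] show "bounded_op E" "cinner (E x) y = cinner x (E y)" "D (E x) = 0"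
    "D x = 0 \<Longrightarrow> E x = x"
    unfolding E_def[symmetric] by blast+
qed

lemma E_D: "E (D x) = 0"
  by (rule cinner_ext) (simp add: E_self_adjoint D_self_adjoint D_E cinner.zero_left cinner.zero_right)

lemma E_E: "E (E x) = E x"
  by (simp add: E_fixed D_E)

lemma A_E: "A (E x) = E x" and E_A: "E (A x) = E x"
  by (simp_all add: A_eq D_E E_D bounded_op_linear[OF bounded_D] bounded_op_linear[OF bounded_E])

text \<open>Preserving the seminorm of \<open>D\<close>, the operator \<open>T\<close> maps its null
  space \<open>ker D\<close> into itself.\<close>

lemma E_T_E: "E (T (E x)) = T (E x)"
proof (rule E_fixed)
  have "cinner (D (T (E x))) (D (T (E x))) = 0"
    by (simp add: cinner_D_T D_E cinner.zero_left)
  then show "D (T (E x)) = 0"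
    by (simp add: cinner_self_eq_0)
qed

lemma bounded_F: "bounded_op F"
  using bounded_op_minus[OF bounded_op_ident bounded_E] by (simp add: F_def[abs_def])

lemma F_self_adjoint: "cinner (F x) y = cinner x (F y)"
  by (simp add: F_def cinner.diff_left cinner.diff_right E_self_adjoint)

lemma F_E: "F (E x) = 0" and E_F: "E (F x) = 0" and F_F: "F (F x) = F x"
  by (simp_all add: F_def E_E bounded_op_linear[OF bounded_E])

lemma bounded_X: "bounded_op X"
  using bounded_op_compose[OF bounded_F bounded_T] by (simp add: X_def[abs_def])

lemma X_E: "X (E x) = 0" and E_X: "E (X x) = 0" and F_X: "F (X x) = X x" and X_F: "X (F x) = X x"
  by (simp_all add: X_def F_def E_T_E E_E bounded_op_linear[OF bounded_E] bounded_op_linear[OF bounded_T])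

lemma T_eq: "T x = E (T x) + X x"
  by (simp add: X_def F_def)

text \<open>The only use of the quasi-Brownian identity: \<open>D T - T D\<close> has values in
  \<open>ker D\<close>, so \<open>F\<close> annihilates it, while \<open>D\<close> does not feel the
  difference between \<open>T\<close> and \<open>X\<close>.\<close>

lemma D_X: "D (X x) = X (D x)"
proof -
  have "E (D (T x) - T (D x)) = D (T x) - T (D x)"
    by (rule E_fixed) (simp add: bounded_op_linear[OF bounded_D] D_D_T)
  then show ?thesis
    by (simp add: X_def F_def bounded_op_linear[OF bounded_D] bounded_op_linear[OF bounded_E] D_E E_D algebra_simps)
qed

lemma X_A: "X (A x) = A (X x)"
  by (simp add: A_eq bounded_op_linear[OF bounded_X] D_X)

text \<open>\<open>D\<close> commutes with \<open>X\<close> and with its adjoint \<open>X'\<close>,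
  and \<open>T\<close> preserves the seminorm of \<open>D\<close>; hence \<open>X' X - I\<close>
  maps into the kernel of \<open>D\<close>. As \<open>E X' = 0\<close>, it equals
  \<open>- E\<close>.\<close>

lemma cinner_X: "cinner (X x) (X y) = cinner (F x) y"
proof -
  define X' where "X' = cadj X"
  have adj: "cinner (X u) v = cinner u (X' v)" for u v
    unfolding X'_def by (rule cinner_cadj[OF bounded_X])
  have D_X': "D (X' u) = X' (D u)" for u
    by (rule cinner_ext_right) (simp add: D_X flip: D_self_adjoint adj)
  have E_X': "E (X' u) = 0" for u
    by (rule cinner_ext_right) (simp add: X_E cinner.zero_left cinner.zero_right flip: E_self_adjoint adj)
  define w where "w = X' (X x) - x"
  have "cinner (D (D (X' (X x)))) z = cinner (D (D x)) z" for z
  proof -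
    have "cinner z (D (D (X' (X x)))) = cinner (D z) (X' (D (X x)))"
      by (simp only: D_self_adjoint D_X')
    also have "\<dots> = cinner (D (X z)) (D (X x))"
      by (simp only: adj[symmetric] D_X)
    also have "\<dots> = cinner (D (T z)) (D (T x))"
      by (simp add: X_def F_def bounded_op_linear[OF bounded_D] D_E)
    also have "\<dots> = cinner (D z) (D x)"
      by (rule cinner_D_T)
    also have "\<dots> = cinner z (D (D x))"
      by (rule D_self_adjoint)
    finally have "cinner z (D (D (X' (X x)))) = cinner z (D (D x))" .
    then show ?thesis
      by (metis cinner_commute)
  qed
  then have "D (D (X' (X x))) = D (D x)"
    by (rule cinner_ext)
  then have "D (D w) = 0"
    by (simp add: w_def bounded_op_linear[OF bounded_D])
  then have "E w = w"
    using E_fixed D_eq_0 by blast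
  moreover have "E w = - E x"
    by (simp add: w_def bounded_op_linear[OF bounded_E] E_X')
  ultimately have "X' (X x) = F x"
    by (simp add: w_def F_def algebra_simps)
  then show ?thesis
    using adj[of y "X x"] by (metis cinner_commute)
qed

lemma cinner_E_X: "cinner (E x) (X y) = 0" "cinner (X y) (E x) = 0"
  by (simp_all add: E_self_adjoint E_X cinner.zero_right E_self_adjoint[symmetric] cinner.zero_left)

text \<open>The ranges of \<open>E T\<close> and \<open>X\<close> are orthogonal, so the form of
  \<open>X\<close> can be subtracted from that of \<open>T\<close>. What remains is I on
  \<open>ker D\<close> and \<Delta> on its complement.\<close>

lemma cinner_E_T: "cinner (E (T x)) (E (T y)) = cinner (A x - F x) y"
proof -
  have "cinner (T x) (T y) = cinner (E (T x) + X x) (E (T y) + X y)"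
    by (simp flip: T_eq)
  then show ?thesis
    by (simp add: cinner_add_left cinner_add_right cinner_E_X cinner.diff_left cinner_X cinner_A)
qed

subsection \<open>Functions of \<open>T\<^sup>*T\<close>\<close>

text \<open>A substitute for functions of \<open>A\<close>: the class contains the inverses and
  square roots below, its members commute with each other, and they commute with \<open>E\<close>
  and \<open>X\<close> because those commute with \<open>A\<close>.\<close>

definition bicommutant :: "('a \<Rightarrow> 'a) \<Rightarrow> bool" where
  "bicommutant S \<longleftrightarrow> bounded_op S
     \<and> (\<forall>Q. bounded_op Q \<longrightarrow> (\<forall>x. Q (A x) = A (Q x)) \<longrightarrow> (\<forall>x. Q (S x) = S (Q x)))"

lemma bicommutant_bounded: "bicommutant S \<Longrightarrow> bounded_op S"
  and bicommutantD: "bicommutant S \<Longrightarrow> bounded_op Q \<Longrightarrow> (\<And>x. Q (A x) = A (Q x)) \<Longrightarrow> Q (S x) = S (Q x)"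
  by (auto simp: bicommutant_def)

lemma bicommutant_ident: "bicommutant (\<lambda>x. x)" and bicommutant_A: "bicommutant A"
  by (auto simp: bicommutant_def bounded_op_ident bounded_A)

lemma bicommutant_compose: "bicommutant R \<Longrightarrow> bicommutant S \<Longrightarrow> bicommutant (\<lambda>x. R (S x))"
  by (auto simp: bicommutant_def bounded_op_compose)

lemma bicommutant_plus: "bicommutant R \<Longrightarrow> bicommutant S \<Longrightarrow> bicommutant (\<lambda>x. R x + S x)"
  by (auto simp: bicommutant_def bounded_op_plus bounded_op_add)

lemma bicommutant_funpow: "bicommutant S \<Longrightarrow> bicommutant (S ^^ n)"
  by (induction n) (auto simp: comp_def id_def intro: bicommutant_ident bicommutant_compose)

lemma bicommutant_commute:
  assumes R: "bicommutant R" and S: "bicommutant S"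
  shows "R (S x) = S (R x)"
  by (rule bicommutantD[OF S bicommutant_bounded[OF R]])
    (rule bicommutantD[OF R bounded_A, symmetric], rule refl)

lemma bicommutant_E: "bicommutant S \<Longrightarrow> E (S x) = S (E x)"
  and bicommutant_F: "bicommutant S \<Longrightarrow> F (S x) = S (F x)"
  and bicommutant_X: "bicommutant S \<Longrightarrow> X (S x) = S (X x)"
proof -
  assume S: "bicommutant S"
  show E: "E (S x) = S (E x)"
    by (rule bicommutantD[OF S bounded_E]) (simp add: E_A A_E)
  show "F (S x) = S (F x)"
    by (simp add: F_def E bounded_op_diff[OF bicommutant_bounded[OF S]])
  show "X (S x) = S (X x)"
    by (rule bicommutantD[OF S bounded_X X_A])
qed

section \<open>The inverses of \<open>A\<close> and \<open>I + A\<close>\<close>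

lemma A_self_adjoint: "cinner (A x) y = cinner x (A y)"
  by (simp add: cinner_A cinner_A_right)

lemma A_bounded_below: "(norm x)\<^sup>2 \<le> Re (cinner (A x) x)"
  using power_mono[OF norm_T_ge norm_ge_zero, of x 2] by (simp add: cinner_A cinner_self)

definition B :: "'a \<Rightarrow> 'a" where "B = inv A"

lemma A_B: "A (B x) = x" and B_A: "B (A x) = x" and B_self_adjoint: "cinner (B x) y = cinner x (B y)"
  and bounded_B: "bounded_op B"
  unfolding B_def by (rule bounded_below_inverse[OF bounded_A A_self_adjoint A_bounded_below])+

lemma bicommutant_B: "bicommutant B"
  unfolding bicommutant_def B_def
  using bounded_below_inverse(3,5)[OF bounded_A A_self_adjoint A_bounded_below] by blast

lemma B_E: "B (E x) = E x"
  using B_A[of "E x"] by (simp add: A_E)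

definition A1 :: "'a \<Rightarrow> 'a" where "A1 x = x + A x"

lemma bicommutant_A1: "bicommutant A1"
  using bicommutant_plus[OF bicommutant_ident bicommutant_A] by (simp add: A1_def[abs_def])

lemmas bounded_A1 = bicommutant_bounded[OF bicommutant_A1]

lemma A1_self_adjoint: "cinner (A1 x) y = cinner x (A1 y)"
  by (simp add: A1_def cinner_add_left cinner_add_right A_self_adjoint)

lemma A1_bounded_below: "(norm x)\<^sup>2 \<le> Re (cinner (A1 x) x)"
  using order_trans[OF zero_le_power2 A_bounded_below[of x]]
  by (simp add: A1_def cinner_add_left cinner_self)

definition P :: "'a \<Rightarrow> 'a" where "P = inv A1"

lemma P_A1: "P (A1 x) = x" and P_self_adjoint: "cinner (P x) y = cinner x (P y)"
  and bounded_P: "bounded_op P"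
  unfolding P_def by (rule bounded_below_inverse[OF bounded_A1 A1_self_adjoint A1_bounded_below])+

text \<open>An operator commutes with \<open>A\<close> exactly when it commutes with
  \<open>I + A\<close>, so inverse and root of the latter qualify as well.\<close>

lemma bicommutant_if_commute_A1:
  assumes "bounded_op S" "\<And>Q x. bounded_op Q \<Longrightarrow> (\<And>x. Q (A1 x) = A1 (Q x)) \<Longrightarrow> Q (S x) = S (Q x)"
  shows "bicommutant S"
  using assms by (auto simp: bicommutant_def A1_def bounded_op_add)

lemma bicommutant_P: "bicommutant P"
  unfolding P_def
  by (rule bicommutant_if_commute_A1)
    (use bounded_below_inverse(3,5)[OF bounded_A1 A1_self_adjoint A1_bounded_below] in blast)+

subsection \<open>Moments of the Cauchy dual\<close>

lemma cauchy_dual_apply: "cauchy_dual T x = T (B x)"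
  by (simp add: cauchy_dual_def B_def A_def)

lemma bounded_cauchy_dual: "bounded_op (cauchy_dual T)"
proof -
  have "cauchy_dual T = (\<lambda>x. T (B x))"
    by (simp add: fun_eq_iff cauchy_dual_apply)
  then show ?thesis
    by (simp add: bounded_op_compose bounded_T bounded_B)
qed

text \<open>The squared norm of the image of \<open>x\<close> is the form of \<open>B\<close> at
  \<open>x\<close>, and \<open>B\<close> is a contraction.\<close>

lemma contraction_cauchy_dual: "contraction (cauchy_dual T)"
  unfolding contraction_def
proof (intro conjI allI bounded_cauchy_dual)
  fix x
  have B_le: "norm (B x) \<le> norm x"
    using bounded_below_bij(2)[OF bounded_A A_self_adjoint A_bounded_below, of "B x"] by (simp add: A_B)
  have "(norm (T (B x)))\<^sup>2 = cmod (cinner x (B x))"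
    using cinner_A[of "B x" "B x"] by (simp add: A_B cinner_self norm_power)
  also have "\<dots> \<le> norm x * norm (B x)"
    by (rule Cauchy_Schwarz_cinner)
  also have "\<dots> \<le> (norm x)\<^sup>2"
    using mult_left_mono[OF B_le, of "norm x"] by (simp add: power2_eq_square)
  finally show "norm (cauchy_dual T x) \<le> norm x"
    by (simp add: cauchy_dual_apply power2_le_iff_abs_le)
qed

lemma cadj_cauchy_dual: "cadj (cauchy_dual T) x = B (cadj T x)"
proof -
  have "cadj (cauchy_dual T) = (\<lambda>x. B (cadj T x))"
    by (rule cadj_unique[OF bounded_cauchy_dual])
      (simp add: cauchy_dual_apply cinner_cadj[OF bounded_T] B_self_adjoint)
  then show ?thesis by simp
qed

text \<open>The assumption \<open>SE\<close> expresses f(1) = 1. Thus \<open>S\<close> acts as I on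
  the summand \<open>E T\<close>, whose form is \<open>A - F\<close>, and passes through
  \<open>X\<close>, whose form is \<open>F\<close>.\<close>

lemma cadj_T_bicommutant_T:
  assumes S: "bicommutant S" and SE: "\<And>x. S (E x) = E x"
  shows "cadj T (S (T x)) = A x + S x - x"
proof (rule cinner_ext)
  fix y
  have E: "E (S u) = E u" for u
    by (simp add: bicommutant_E[OF S] SE)
  have "S (T x) = E (T x) + X (S x)"
    by (subst T_eq) (simp add: bounded_op_add[OF bicommutant_bounded[OF S]] SE bicommutant_X[OF S])
  then have "cinner (cadj T (S (T x))) y = cinner (E (T x) + X (S x)) (E (T y) + X y)"
    by (simp add: cinner_cadj'[OF bounded_T] flip: T_eq)
  also have "\<dots> = cinner (A x - F x) y + cinner (F (S x)) y"
    by (simp add: cinner_add_left cinner_add_right cinner_E_X cinner_E_T cinner_X)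
  also have "\<dots> = cinner (A x + S x - x) y"
    by (simp add: F_def E add.commute add_diff_eq flip: cinner_add_left)
  finally show "cinner (cadj T (S (T x))) y = cinner (A x + S x - x) y" .
qed

text \<open>The exponent is positive for \<open>n = 0\<close> only, so \<open>op_ipow\<close>
  changes branch between 0 and 1; this is why the facts below split cases on
  \<open>n\<close>.\<close>

definition Apow :: "nat \<Rightarrow> 'a \<Rightarrow> 'a" where "Apow n = op_ipow A (1 - 2 * int n)"

lemma Apow_0: "Apow 0 = A"
  by (simp add: Apow_def op_ipow_def fun_eq_iff)

lemma Apow_Suc: "Apow (Suc n) = B ^^ Suc (2 * n)"
proof -
  have "nat (- (1 - 2 * int (Suc n))) = Suc (2 * n)"
    by simp
  then show ?thesis
    unfolding Apow_def op_ipow_def B_def by (simp del: funpow.simps)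
qed

lemma bicommutant_Apow: "bicommutant (Apow n)"
  by (cases n) (simp_all only: Apow_0 Apow_Suc bicommutant_A bicommutant_funpow[OF bicommutant_B])

lemma Apow_E: "Apow n (E x) = E x"
proof -
  have "(B ^^ k) (E x) = E x" for k
    by (induction k) (simp_all add: B_E)
  then show ?thesis
    by (cases n) (simp_all only: Apow_0 Apow_Suc A_E)
qed

lemma Apow_B_B: "Apow n (B (B x)) = Apow (Suc n) x"
  by (cases n) (simp_all add: Apow_0 Apow_Suc A_B funpow_swap1)

lemma cauchy_dual_moments:
  "((cadj (cauchy_dual T) ^^ n) \<circ> (cauchy_dual T ^^ n)) x = P (x + Apow n x)"
proof (induction n arbitrary: x)
  case 0
  show ?case
    using P_A1[of x] by (simp add: Apow_0 A1_def)
next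
  case (Suc n)
  define G where "G x = P (x + Apow n x)" for x
  have G: "bicommutant G"
    using bicommutant_compose[OF bicommutant_P bicommutant_plus[OF bicommutant_ident bicommutant_Apow[of n]]]
    by (simp add: G_def[abs_def])
  \<comment> \<open>At the spectral value 1 the symbol is (1 + 1) / (1 + 1) = 1.\<close>
  have GE: "G (E u) = E u" for u
    using P_A1[of "E u"] by (simp add: G_def Apow_E A1_def A_E)
  note lin = bounded_op_linear[OF bounded_B] bounded_op_linear[OF bounded_P]
  have "((cadj (cauchy_dual T) ^^ Suc n) \<circ> (cauchy_dual T ^^ Suc n)) x
      = cadj (cauchy_dual T) (((cadj (cauchy_dual T) ^^ n) \<circ> (cauchy_dual T ^^ n)) (cauchy_dual T x))"
    by (simp add: funpow_swap1)
  also have "\<dots> = B (cadj T (G (T (B x))))"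
    by (simp only: Suc G_def cadj_cauchy_dual cauchy_dual_apply)
  also have "\<dots> = (B x - B (B x)) + B (G (B x))"
    by (simp add: cadj_T_bicommutant_T[OF G GE] A_B lin)
  also have "B (G (B x)) = P (B (B x) + Apow n (B (B x)))"
    by (simp add: bicommutant_commute[OF bicommutant_B G]) (simp add: G_def)
  \<comment> \<open>Because (I + A)(B - B^2) = I - B^2; the square of \<open>B\<close> then cancels
    against the one produced by \<open>B G B\<close>.\<close>
  also have "B x - B (B x) = P (x - B (B x))"
    using P_A1[of "B x - B (B x)"] by (simp add: A1_def A_B bounded_op_linear[OF bounded_A])
  finally show ?case
    by (simp add: Apow_B_B lin)
qed

subsection \<open>Subnormality of the Cauchy dual\<close>

text \<open>The moments are those of the operator measure with density \<open>(I + A)\<^sup>-\<^sup>1\<close> at \<open>1\<close> and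
  \<open>A (I + A)\<^sup>-\<^sup>1\<close> at \<open>A\<^sup>-\<^sup>2\<close>. On \<open>ker \<Delta>\<close> the two atoms coincide, so the densities are replaced there
  by \<open>I\<close> and \<open>0\<close>; their square roots are \<open>R\<close> and \<open>S\<close> below, with \<open>C = (I + A)\<^sup>1\<^sup>/\<^sup>2\<close> and
  \<open>L = A\<^sup>1\<^sup>/\<^sup>2\<close>.\<close>

definition C :: "'a \<Rightarrow> 'a" where "C = op_sqrt A1"
text \<open>The inverse square root of \<open>I + A\<close>, obtained as its inverse times its
  root.\<close>

definition C' :: "'a \<Rightarrow> 'a" where "C' x = P (C x)"
definition L :: "'a \<Rightarrow> 'a" where "L = op_sqrt A"

lemma positive_A1: "positive_op A1" and positive_A: "positive_op A"
  using order_trans[OF zero_le_power2 A_bounded_below] order_trans[OF zero_le_power2 A1_bounded_below]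
  by (auto intro!: positive_opI bounded_A1 bounded_A A1_self_adjoint A_self_adjoint)

lemma C_C: "C (C x) = A1 x" and L_L: "L (L x) = A x"
  unfolding C_def L_def by (rule op_sqrt_square[OF positive_A1] op_sqrt_square[OF positive_A])+

lemma C_self_adjoint: "cinner (C x) y = cinner x (C y)" and L_self_adjoint: "cinner (L x) y = cinner x (L y)"
  unfolding C_def L_def
  by (rule positive_op_self_adjoint[OF positive_op_sqrt[OF positive_A1]]
      positive_op_self_adjoint[OF positive_op_sqrt[OF positive_A]])+

lemma bicommutant_L: "bicommutant L"
  unfolding bicommutant_def L_def
  using op_sqrt_commute[OF positive_A] positive_op_bounded[OF positive_op_sqrt[OF positive_A]] by blast

lemma bicommutant_C: "bicommutant C"
  unfolding C_def
  by (rule bicommutant_if_commute_A1)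
    (use op_sqrt_commute[OF positive_A1] positive_op_bounded[OF positive_op_sqrt[OF positive_A1]] in blast)+

lemma bicommutant_C': "bicommutant C'"
  using bicommutant_compose[OF bicommutant_P bicommutant_C] by (simp add: C'_def[abs_def])

lemma C_P: "C (P x) = P (C x)"
  by (rule bicommutant_commute[OF bicommutant_C bicommutant_P])

lemma C_C': "C (C' x) = x" and C'_C: "C' (C x) = x"
  by (simp_all add: C'_def C_P C_C P_A1)

lemma C'_self_adjoint: "cinner (C' x) y = cinner x (C' y)"
  by (simp add: C'_def P_self_adjoint C_self_adjoint C_P)

lemmas function_linear = bounded_op_linear[OF bicommutant_bounded[OF bicommutant_B]]
  bounded_op_linear[OF bicommutant_bounded[OF bicommutant_C]]
  bounded_op_linear[OF bicommutant_bounded[OF bicommutant_C']]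
  bounded_op_linear[OF bicommutant_bounded[OF bicommutant_L]]
  bounded_op_linear[OF bounded_A] bounded_op_linear[OF bounded_E] bounded_op_linear[OF bounded_F]
  bounded_op_linear[OF bounded_X]

lemmas function_commute =
  bicommutant_E[OF bicommutant_A] bicommutant_F[OF bicommutant_A] bicommutant_X[OF bicommutant_A]
  bicommutant_E[OF bicommutant_B] bicommutant_F[OF bicommutant_B] bicommutant_X[OF bicommutant_B]
  bicommutant_E[OF bicommutant_C] bicommutant_F[OF bicommutant_C] bicommutant_X[OF bicommutant_C]
  bicommutant_E[OF bicommutant_C'] bicommutant_F[OF bicommutant_C'] bicommutant_X[OF bicommutant_C']
  bicommutant_E[OF bicommutant_L] bicommutant_F[OF bicommutant_L] bicommutant_X[OF bicommutant_L]
  bicommutant_commute[OF bicommutant_C bicommutant_B] bicommutant_commute[OF bicommutant_C' bicommutant_B]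
  bicommutant_commute[OF bicommutant_L bicommutant_B] bicommutant_commute[OF bicommutant_C' bicommutant_L]

lemmas projection_simps = E_E F_F E_F F_E X_E E_X F_X X_F B_E A_E

section \<open>Two isometries and the embeddings that intertwine them with the Cauchy dual\<close>

definition M :: "'a \<Rightarrow> 'a" where "M x = E x + B (C (F x))"
text \<open>The inverse of \<open>R\<close> is \<open>E + C F\<close>, so \<open>M\<close> is
  \<open>B\<close> times that inverse, and \<open>U\<close> is the Cauchy dual conjugated by
  \<open>R\<close>.\<close>

definition U :: "'a \<Rightarrow> 'a" where "U x = E (T (M x)) + X (B x)"
text \<open>\<open>X\<close> vanishes on the kernel of \<open>D\<close>; adding \<open>E\<close>
  makes it isometric on the whole space. The range of \<open>S\<close> avoids that kernel, so the
  choice there is harmless.\<close>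

definition W :: "'a \<Rightarrow> 'a" where "W x = E x + X x"
definition R :: "'a \<Rightarrow> 'a" where "R x = E x + C' (F x)"
definition S :: "'a \<Rightarrow> 'a" where "S x = L (C' (F x))"

lemma bounded_M: "bounded_op M"
  unfolding M_def
  by (intro bounded_op_plus bounded_E bounded_op_compose[OF bounded_B]
      bounded_op_compose[OF bicommutant_bounded[OF bicommutant_C]] bounded_F)

lemma bounded_U: "bounded_op U"
  unfolding U_def
  by (intro bounded_op_plus bounded_op_compose[OF bounded_E] bounded_op_compose[OF bounded_T]
      bounded_op_compose[OF bounded_X] bounded_M bounded_B)

lemma bounded_W: "bounded_op W"
  unfolding W_def by (intro bounded_op_plus bounded_E bounded_X)

lemma bounded_R: "bounded_op R"
  unfolding R_def
  by (intro bounded_op_plus bounded_E bounded_op_compose[OF bicommutant_bounded[OF bicommutant_C']] bounded_F)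

lemma bounded_S: "bounded_op S"
  unfolding S_def
  by (intro bounded_op_compose[OF bicommutant_bounded[OF bicommutant_C']]
      bounded_op_compose[OF bicommutant_bounded[OF bicommutant_L]] bounded_F)

text \<open>On the complement of \<open>ker D\<close> the form is B^2 (A - I)(A + I) + B^2 = I: the
  weight I + A supplies the missing factor of A^2 - I.\<close>

lemma U_isometric: "cinner (U x) (U y) = cinner x y"
proof -
  have M_sa: "cinner (M u) v = cinner u (M v)" for u v
    by (simp add: M_def cinner_add_left cinner_add_right E_self_adjoint B_self_adjoint C_self_adjoint
        F_self_adjoint function_commute)
  have FM: "F (M x) = B (C (F x))"
    by (simp add: M_def function_linear function_commute projection_simps)
  have AM: "A (M x) = E x + C (F x)"
    by (simp add: M_def function_linear projection_simps A_B)
  have "M (A (M x) - F (M x)) = E x + F x - B (B (F x))"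
    unfolding AM FM M_def
    by (simp add: function_linear function_commute projection_simps C_C A1_def A_B B_A algebra_simps)
  moreover have "B (F (B x)) = B (B (F x))"
    by (simp add: function_commute)
  ultimately have "M (A (M x) - F (M x)) + B (F (B x)) = x"
    by (simp add: F_def)
  moreover have "cinner (U x) (U y) = cinner (M (A (M x) - F (M x)) + B (F (B x))) y"
    by (simp add: U_def cinner_add_left cinner_add_right cinner_E_X cinner_E_T cinner_X
        M_sa B_self_adjoint)
  ultimately show ?thesis by simp
qed

lemma W_isometric: "cinner (W x) (W y) = cinner x y"
proof -
  have "cinner (W x) (W y) = cinner (E x) (E y) + cinner (F x) y"
    by (simp add: W_def cinner_add_left cinner_add_right cinner_E_X cinner_X)
  also have "cinner (E x) (E y) = cinner (E x) y"
    by (simp add: E_self_adjoint E_E)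
  finally show ?thesis
    by (simp add: F_def flip: cinner_add_left)
qed

lemma U_R: "U (R x) = R (cauchy_dual T x)"
proof -
  have "M (R x) = E x + B (F x)"
    by (simp add: M_def R_def function_linear function_commute projection_simps C_C')
  also have "\<dots> = B (E x + F x)"
    by (simp add: function_linear B_E)
  finally have "M (R x) = B x"
    by (simp add: F_def)
  moreover have "X (B (R x)) = C' (X (B x))"
    by (simp add: R_def function_linear function_commute projection_simps)
  moreover have "C' (F (T (B x))) = C' (X (B x))"
    by (simp add: X_def)
  ultimately show ?thesis
    by (simp add: U_def R_def[of "T (B x)"] cauchy_dual_apply)
qed

lemma W_B_S: "W (B (S x)) = S (cauchy_dual T x)"
proof -
  have "W (B (S x)) = L (C' (X (B x)))"
    by (simp add: W_def S_def function_linear function_commute projection_simps)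
  then show ?thesis
    by (simp add: S_def cauchy_dual_apply X_def)
qed

text \<open>The squared weights add up to E + (I + A)^-1 (I + A) F = I.\<close>

lemma R_S_isometric: "cinner (R x) (R y) + cinner (S x) (S y) = cinner x y"
proof -
  have "cinner (R u) v = cinner u (R v)" for u v
    by (simp add: R_def cinner_add_left cinner_add_right E_self_adjoint C'_self_adjoint
        F_self_adjoint function_commute)
  moreover have "cinner (S u) v = cinner u (S v)" for u v
    by (simp add: S_def L_self_adjoint C'_self_adjoint F_self_adjoint function_commute)
  ultimately have "cinner (R x) (R y) + cinner (S x) (S y) = cinner (R (R x) + S (S x)) y"
    by (simp add: cinner_add_left)
  also have "R (R x) = E x + C' (C' (F x))"
    by (simp add: R_def function_linear function_commute projection_simps)
  also have "S (S x) = C' (C' (A (F x)))"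
    by (simp add: S_def function_linear function_commute projection_simps bicommutant_commute[OF bicommutant_L bicommutant_C'] L_L
        del: bicommutant_commute[OF bicommutant_C' bicommutant_L])
  also have "(E x + C' (C' (F x))) + C' (C' (A (F x))) = E x + C' (C' (A1 (F x)))"
    by (simp add: A1_def function_linear add.assoc)
  also have "\<dots> = x"
    by (simp add: C'_C F_def flip: C_C)
  finally show ?thesis .
qed

text \<open>Index \<open>True\<close> carries the atom 1, with modulus I, and index
  \<open>False\<close> the atom A^-2, with modulus \<open>B\<close>.\<close>

lemma subnormal_cauchy_dual: "subnormal (cauchy_dual T)"
proof (rule subnormal_if_in_quasinormal_sum[where W = "\<lambda>j. if j then U else W"
      and B = "\<lambda>j. if j then (\<lambda>x. x) else B" and R = "\<lambda>j. if j then R else S"])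
  show "(if j then U else W) ((if j then \<lambda>x. x else B) x) = (if j then \<lambda>x. x else B) ((if j then U else W) x)"
    for j x
    by (simp add: W_def function_linear function_commute)
qed (auto simp: bounded_cauchy_dual bounded_U bounded_W bounded_R bounded_S bounded_B bounded_op_ident
    U_isometric W_isometric B_self_adjoint U_R W_B_S R_S_isometric)

end

theorem mainTheorem4:
  fixes T :: "'a::chilbert \<Rightarrow> 'a"
  assumes "quasi_brownian T"
  shows "subnormal (cauchy_dual T) \<and> contraction (cauchy_dual T) \<and>
    (\<forall>n::nat. (cadj (cauchy_dual T) ^^ n) \<circ> (cauchy_dual T ^^ n)
       = inv (\<lambda>x. x + cadj T (T x)) \<circ>
           (\<lambda>x. x + op_ipow (cadj T \<circ> T) (1 - 2 * int n) x))"
proof -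
  interpret quasi_brownian_isometry T
    using assms by unfold_locales
  have "inv (\<lambda>x. x + cadj T (T x)) = P"
    by (simp add: P_def A1_def[abs_def] A_apply)
  moreover have "op_ipow (cadj T \<circ> T) (1 - 2 * int n) = Apow n" for n
    by (simp add: Apow_def A_def)
  ultimately show ?thesis
    using subnormal_cauchy_dual contraction_cauchy_dual cauchy_dual_moments
    by (simp add: fun_eq_iff)
qed

end
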